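(* Let $X$ be a connected CW-complex, $\mathbf{k}$ a commutative ring with unit, and $\nu\colon\pi_1(X)\twoheadrightarrow\mathbb{Z}$ an epimorphism. Let $R=\mathbf{k}\mathbb{Z}_\nu$ or $R=\widehat{\mathbf{k}\mathbb{Z}}_{\hat\nu}$. Then: (1) For each $r$ and $q$, the $\operatorname{gr}(R)$-module ${}_qE^r_*=\bigoplus_{s\ge0}E^r_{-s,s+q}(X,R)$ is generated by ${}_qE^r_0=E^r_{0,q}(X,R)$. (2) The spectral sequence filtration on $H_*(X,R)$ coincides with the $(x)$-adic filtration; that is, $F^sH_*(X,R)=x^s\cdot H_*(X,R)$ for all $s\ge 0$.
   Context: Write $\pi=\pi_1(X)$ and $\Lambda=\mathbf{k}\mathbb{Z}=\mathbf{k}[t^{\pm1}]$, with augmentation ideal $J=(t-1)\Lambda$ and $x=t-1$. Its $J$-adic completion $\widehat{\mathbf{k}\mathbb{Z}}$ is identified with $\mathbf{k}[[x]]$, the completion map $\iota$ sending $t\mapsto 1+x$. $\mathbf{k}\mathbb{Z}_\nu$ is $\Lambda$ as a right $\mathbf{k}\pi$-module via the linear extension $\bar\nu\colon\mathbf{k}\pi\to\Lambda$ of $\nu$, and $\widehat{\mathbf{k}\mathbb{Z}}_{\hat\nu}$ is $\mathbf{k}[[x]]$ as a right $\mathbf{k}\pi$-module via $\hat\nu=\iota\circ\bar\nu$. In both cases $C_\bullet(X,R)=R\otimes_{\mathbf{k}\pi}C_\bullet(\widetilde X,\mathbf{k})$ ($\widetilde X$ the universal cover) is a complex of free $R$-modules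 with the filtration $F^nC_\bullet(X,R)=x^n\cdot C_\bullet(X,R)$, $n\ge 0$ (equal to the $I$-adic filtration, $I$ the augmentation ideal of $\mathbf{k}\pi$). $E^\bullet(X,R)$ is the spectral sequence of the increasing filtration $F_{-n}=F^n$, with $d^r$ of bidegree $(-r,r-1)$. Multiplication by $x^n$ induces on each ${}_qE^r_*$ the structure of a graded module over $\operatorname{gr}(R)=\bigoplus_nx^nR/x^{n+1}R=\mathbf{k}[x]$. The spectral sequence filtration on homology is $F^sH_q(X,R)=\operatorname{im}\big(H_q(F^sC_\bullet(X,R))\to H_q(X,R)\big)$. *)

theory Defs
  imports
    "HOL-Homology.Homology"
    "HOL-Computational_Algebra.Computational_Algebra"
begin

section \<open>CW-complexes\<close>

text \<open>Discs live in the space of real sequences, as the spheres \<^term>\<open>nsphere p\<close> do; in particular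
  the boundary of the disc of dimension \<open>p + 1\<close> is the underlying set of \<^term>\<open>nsphere p\<close>.\<close>

definition disc :: "nat \<Rightarrow> (nat \<Rightarrow> real) set" where
  "disc n = {v. (\<Sum>i<n. (v i)\<^sup>2) \<le> 1 \<and> (\<forall>i\<ge>n. v i = 0)}"

definition open_disc :: "nat \<Rightarrow> (nat \<Rightarrow> real) set" where
  "open_disc n = {v. (\<Sum>i<n. (v i)\<^sup>2) < 1 \<and> (\<forall>i\<ge>n. v i = 0)}"

definition disc_space :: "nat \<Rightarrow> (nat \<Rightarrow> real) topology" where
  "disc_space n = subtopology (powertop_real UNIV) (disc n)"

record ('i, 'a) cell_structure =
  cells :: "'i set"
  cdim :: "'i \<Rightarrow> nat"
  charmap :: "'i \<Rightarrow> (nat \<Rightarrow> real) \<Rightarrow> 'a"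

text \<open>The characteristic maps are part of the data; they serve as orientations of the cells.\<close>

definition cw_complex :: "'a::topological_space set \<Rightarrow> ('i, 'a) cell_structure \<Rightarrow> bool" where
  "cw_complex X K \<longleftrightarrow>
     Hausdorff_space (top_of_set X) \<and>
     (\<forall>\<alpha>\<in>cells K.
        continuous_map (disc_space (cdim K \<alpha>)) (top_of_set X) (charmap K \<alpha>) \<and>
        embedding_map (subtopology (powertop_real UNIV) (open_disc (cdim K \<alpha>))) (top_of_set X)
          (charmap K \<alpha>)) \<and>
     disjoint_family_on (\<lambda>\<alpha>. charmap K \<alpha> ` open_disc (cdim K \<alpha>)) (cells K) \<and>
     (\<Union>\<alpha>\<in>cells K. charmap K \<alpha> ` open_disc (cdim K \<alpha>)) = X \<and>
     (\<forall>\<alpha>\<in>cells K. \<exists>F. finite F \<and> F \<subseteq> {\<beta> \<in> cells K. cdim K \<beta> < cdim K \<alpha>} \<and>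
        charmap K \<alpha> ` (disc (cdim K \<alpha>) - open_disc (cdim K \<alpha>))
          \<subseteq> (\<Union>\<beta>\<in>F. charmap K \<beta> ` open_disc (cdim K \<beta>))) \<and>
     (\<forall>A\<subseteq>X. (\<forall>\<alpha>\<in>cells K. closedin (top_of_set X) (A \<inter> charmap K \<alpha> ` disc (cdim K \<alpha>)))
        \<longrightarrow> closedin (top_of_set X) A)"


section \<open>Fundamental group and universal cover\<close>

definition path_class :: "'a::topological_space set \<Rightarrow> (real \<Rightarrow> 'a) \<Rightarrow> (real \<Rightarrow> 'a) set" where
  "path_class X g = {h. homotopic_paths X g h}"

definition class_join ::
  "'a::topological_space set \<Rightarrow> (real \<Rightarrow> 'a) set \<Rightarrow> (real \<Rightarrow> 'a) set \<Rightarrow> (real \<Rightarrow> 'a) set" where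
  "class_join X A B =
     {h. \<exists>f\<in>A. \<exists>g\<in>B. pathfinish f = pathstart g \<and> homotopic_paths X (f +++ g) h}"

definition fundamental_group :: "'a::topological_space set \<Rightarrow> 'a \<Rightarrow> (real \<Rightarrow> 'a) set monoid" where
  "fundamental_group X b =
     \<lparr>carrier = path_class X ` {g. path g \<and> path_image g \<subseteq> X \<and> pathstart g = b \<and> pathfinish g = b},
      monoid.mult = class_join X,
      one = path_class X (\<lambda>_. b)\<rparr>"

text \<open>The standard model of the universal cover: homotopy classes, relative to endpoints, of paths
  starting at the base point \<open>b\<close>. A basis of its topology is given by the sets of all
  classes \<open>[g \<cdot> h]\<close> with \<open>h\<close> a path in an open set \<open>U\<close>. The fundamental group acts on the left by
  \<open>[a] \<cdot> [g] = [a \<cdot> g]\<close>, that is, by \<^const>\<open>class_join\<close>.\<close>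

definition paths_from :: "'a::topological_space set \<Rightarrow> 'a \<Rightarrow> (real \<Rightarrow> 'a) set" where
  "paths_from X b = {g. path g \<and> path_image g \<subseteq> X \<and> pathstart g = b}"

definition universal_cover :: "'a::topological_space set \<Rightarrow> 'a \<Rightarrow> (real \<Rightarrow> 'a) set topology" where
  "universal_cover X b = topology_generated_by
     {{path_class X (g +++ h) | h. path h \<and> path_image h \<subseteq> U \<and> pathstart h = pathfinish g} | g U.
        g \<in> paths_from X b \<and> openin (top_of_set X) U}"

definition cover_proj :: "(real \<Rightarrow> 'a::topological_space) set \<Rightarrow> 'a" where
  "cover_proj A = (THE y. \<exists>g\<in>A. pathfinish g = y)"


section \<open>Cellular chains of the universal cover\<close>

text \<open>The cells of the universal cover are the lifts of the characteristic maps of \<open>X\<close>, so the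
  fundamental group permutes them together with their orientations. Degrees are integers; there
  are no cells in negative degrees.\<close>

type_synonym ('i, 'a) cover_cell = "'i \<times> ((nat \<Rightarrow> real) \<Rightarrow> (real \<Rightarrow> 'a) set)"

definition cover_cells ::
  "'a::topological_space set \<Rightarrow> 'a \<Rightarrow> ('i, 'a) cell_structure \<Rightarrow> int \<Rightarrow> ('i, 'a) cover_cell set" where
  "cover_cells X b K n =
     {(\<alpha>, \<phi>). \<alpha> \<in> cells K \<and> int (cdim K \<alpha>) = n \<and> \<phi> \<in> extensional (disc (cdim K \<alpha>)) \<and>
        continuous_map (disc_space (cdim K \<alpha>)) (universal_cover X b) \<phi> \<and>
        (\<forall>v\<in>disc (cdim K \<alpha>). cover_proj (\<phi> v) = charmap K \<alpha> v)}"

text \<open>A homeomorphism from the open \<open>m\<close>-disc onto the \<open>m\<close>-sphere minus the pole with last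
  coordinate \<open>-1\<close>; the boundary of the disc is sent to that pole.\<close>

definition disc_to_sphere :: "nat \<Rightarrow> (nat \<Rightarrow> real) \<Rightarrow> nat \<Rightarrow> real" where
  "disc_to_sphere m v =
     (\<lambda>i. if i < m then 2 * sqrt (1 - (\<Sum>j<m. (v j)\<^sup>2)) * v i
          else if i = m then 1 - 2 * (\<Sum>j<m. (v j)\<^sup>2) else 0)"

text \<open>For a cell with characteristic map \<open>\<psi>\<close>, the collapse of the \<open>m\<close>-skeleton onto the \<open>m\<close>-sphere
  that sends the complement of the open cell to the pole.\<close>

definition cell_collapse :: "nat \<Rightarrow> ((nat \<Rightarrow> real) \<Rightarrow> 'b) \<Rightarrow> 'b \<Rightarrow> nat \<Rightarrow> real" where
  "cell_collapse m \<psi> y =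
     (if y \<in> \<psi> ` open_disc m then disc_to_sphere m (THE v. v \<in> open_disc m \<and> \<psi> v = y)
      else (\<lambda>i. if i = m then -1 else 0))"

text \<open>The incidence number of a cell \<open>e\<close> and a cell \<open>f\<close> of dimension one less: the degree of the
  attaching map of \<open>e\<close> followed by the collapse onto \<open>f\<close>. For a 1-cell, \<^term>\<open>nsphere 0\<close> consists of
  the two endpoints, and the degree (in reduced homology) gives endpoint minus initial point.\<close>

definition incidence ::
  "('i, 'a) cell_structure \<Rightarrow> ('i, 'a) cover_cell \<Rightarrow> ('i, 'a) cover_cell \<Rightarrow> int" where
  "incidence K e f =
     Brouwer_degree2 (cdim K (fst f)) (cell_collapse (cdim K (fst f)) (snd f) \<circ> snd e)"

text \<open>Chains with coefficients in \<open>'k\<close> are finitely supported functions on cells. In a CW-complex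
  every cell has only finitely many nonzero incidence numbers, so the inner sum is a finite sum.\<close>

definition cellular_chains ::
  "'a::topological_space set \<Rightarrow> 'a \<Rightarrow> ('i, 'a) cell_structure \<Rightarrow> int \<Rightarrow>
     (('i, 'a) cover_cell \<Rightarrow>\<^sub>0 'k::comm_ring_1) set" where
  "cellular_chains X b K n = {c. Poly_Mapping.keys c \<subseteq> cover_cells X b K n}"

definition cellular_boundary ::
  "'a::topological_space set \<Rightarrow> 'a \<Rightarrow> ('i, 'a) cell_structure \<Rightarrow> int \<Rightarrow>
     (('i, 'a) cover_cell \<Rightarrow>\<^sub>0 'k::comm_ring_1) \<Rightarrow> (('i, 'a) cover_cell \<Rightarrow>\<^sub>0 'k)" where
  "cellular_boundary X b K n c =
     (\<Sum>e\<in>Poly_Mapping.keys c. \<Sum>f\<in>{f \<in> cover_cells X b K (n - 1). incidence K e f \<noteq> 0}.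
        Poly_Mapping.single f (Poly_Mapping.lookup c e * of_int (incidence K e f)))"

text \<open>Elements of the group ring \<open>k\<pi>\<close> are finitely supported functions on the fundamental group.\<close>

definition group_ring_carrier :: "('p, 'q) monoid_scheme \<Rightarrow> ('p \<Rightarrow>\<^sub>0 'k::comm_ring_1) set" where
  "group_ring_carrier G = {a. Poly_Mapping.keys a \<subseteq> carrier G}"

definition translate_cell ::
  "'a::topological_space set \<Rightarrow> ('i, 'a) cell_structure \<Rightarrow> (real \<Rightarrow> 'a) set \<Rightarrow>
     ('i, 'a) cover_cell \<Rightarrow> ('i, 'a) cover_cell" where
  "translate_cell X K g e =
     (fst e, restrict (\<lambda>v. class_join X g (snd e v)) (disc (cdim K (fst e))))"

definition group_ring_action ::
  "'a::topological_space set \<Rightarrow> ('i, 'a) cell_structure \<Rightarrow> ((real \<Rightarrow> 'a) set \<Rightarrow>\<^sub>0 'k::comm_ring_1) \<Rightarrow>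
     (('i, 'a) cover_cell \<Rightarrow>\<^sub>0 'k) \<Rightarrow> (('i, 'a) cover_cell \<Rightarrow>\<^sub>0 'k)" where
  "group_ring_action X K a c =
     (\<Sum>g\<in>Poly_Mapping.keys a. \<Sum>e\<in>Poly_Mapping.keys c.
        Poly_Mapping.single (translate_cell X K g e) (Poly_Mapping.lookup a g * Poly_Mapping.lookup c e))"


section \<open>Quotient modules and tensor products\<close>

text \<open>The multiplicative fields of module records are irrelevant and left undefined.\<close>

definition quotient_module :: "('r, 'm) module \<Rightarrow> 'm set \<Rightarrow> ('r, 'm set) module" where
  "quotient_module M N =
     \<lparr>carrier = a_rcosets\<^bsub>M\<^esub> N, monoid.mult = undefined, one = undefined,
      zero = N, add = set_add M, module.smult = (\<lambda>r A. \<Union>z\<in>A. N +>\<^bsub>M\<^esub> (r \<odot>\<^bsub>M\<^esub> z))\<rparr>"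

text \<open>The map into the quotient of \<open>M\<close> by \<open>N\<close> which \<open>f\<close> induces on cosets.\<close>

definition coset_map :: "('r, 'm) module \<Rightarrow> 'm set \<Rightarrow> ('n \<Rightarrow> 'm) \<Rightarrow> 'n set \<Rightarrow> 'm set" where
  "coset_map M N f A = (\<Union>z\<in>A. N +>\<^bsub>M\<^esub> f z)"

text \<open>The tensor product of a commutative ring \<open>'r\<close> with a left module \<open>C\<close> over a ring \<open>P\<close>, where \<open>'r\<close>
  is a right \<open>P\<close>-module via \<open>\<rho>\<close>: the free abelian group on pairs modulo biadditivity and balancing,
  as a module over \<open>'r\<close>.\<close>

definition pairs_module :: "'c set \<Rightarrow> ('r::comm_ring_1, 'r \<times> 'c \<Rightarrow>\<^sub>0 int) module" where
  "pairs_module C =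
     \<lparr>carrier = {u. Poly_Mapping.keys u \<subseteq> UNIV \<times> C}, monoid.mult = undefined, one = undefined,
      zero = 0, add = (+), module.smult = (\<lambda>r. frag_extend (\<lambda>(s, c). frag_of (r * s, c)))\<rparr>"

definition tensor_relators ::
  "('p \<Rightarrow> 'r::comm_ring_1) \<Rightarrow> 'p set \<Rightarrow> 'c::ab_group_add set \<Rightarrow> ('p \<Rightarrow> 'c \<Rightarrow> 'c) \<Rightarrow>
     ('r \<times> 'c \<Rightarrow>\<^sub>0 int) set" where
  "tensor_relators \<rho> P C act =
     {frag_of (r + s, c) - frag_of (r, c) - frag_of (s, c) | r s c. c \<in> C} \<union>
     {frag_of (r, c + d) - frag_of (r, c) - frag_of (r, d) | r c d. c \<in> C \<and> d \<in> C} \<union>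
     {frag_of (r * \<rho> a, c) - frag_of (r, act a c) | r a c. a \<in> P \<and> c \<in> C}"

definition tensor_kernel ::
  "('p \<Rightarrow> 'r::comm_ring_1) \<Rightarrow> 'p set \<Rightarrow> 'c::ab_group_add set \<Rightarrow> ('p \<Rightarrow> 'c \<Rightarrow> 'c) \<Rightarrow>
     ('r \<times> 'c \<Rightarrow>\<^sub>0 int) set" where
  "tensor_kernel \<rho> P C act =
     generate (add_monoid (pairs_module C :: ('r, 'r \<times> 'c \<Rightarrow>\<^sub>0 int) module)) (tensor_relators \<rho> P C act)"

definition tensor_module ::
  "('p \<Rightarrow> 'r::comm_ring_1) \<Rightarrow> 'p set \<Rightarrow> 'c::ab_group_add set \<Rightarrow> ('p \<Rightarrow> 'c \<Rightarrow> 'c) \<Rightarrow>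
     ('r, ('r \<times> 'c \<Rightarrow>\<^sub>0 int) set) module" where
  "tensor_module \<rho> P C act = quotient_module (pairs_module C) (tensor_kernel \<rho> P C act)"


section \<open>The equivariant chain complex\<close>

record ('r, 'c) chain_complex =
  chain_mod :: "int \<Rightarrow> ('r, 'c) module"
  diff :: "int \<Rightarrow> 'c \<Rightarrow> 'c"

text \<open>The complex of the modules \<open>R \<otimes> C\<^sub>n\<close> over \<open>k\<pi>\<close>, with differential induced by the cellular
  boundary; \<open>diff n\<close> lowers the degree from \<open>n\<close> to \<open>n - 1\<close>.\<close>

definition equivariant_complex ::
  "'a::topological_space set \<Rightarrow> 'a \<Rightarrow> ('i, 'a) cell_structure \<Rightarrow>
     (((real \<Rightarrow> 'a) set \<Rightarrow>\<^sub>0 'k::comm_ring_1) \<Rightarrow> 'r::comm_ring_1) \<Rightarrow>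
     ('r, ('r \<times> (('i, 'a) cover_cell \<Rightarrow>\<^sub>0 'k) \<Rightarrow>\<^sub>0 int) set) chain_complex" where
  "equivariant_complex X b K \<rho> =
     (let P = group_ring_carrier (fundamental_group X b) in
      \<lparr>chain_mod = (\<lambda>n. tensor_module \<rho> P (cellular_chains X b K n) (group_ring_action X K)),
       diff = (\<lambda>n. coset_map (pairs_module (cellular_chains X b K (n - 1)))
                  (tensor_kernel \<rho> P (cellular_chains X b K (n - 1)) (group_ring_action X K))
                  (frag_extend (\<lambda>(r, c). frag_of (r, cellular_boundary X b K n c))))\<rparr>)"


section \<open>Homology and the spectral sequence of the filtration by powers of an element\<close>

definition cycles :: "('r, 'c) chain_complex \<Rightarrow> int \<Rightarrow> 'c set" where
  "cycles C n = {z \<in> carrier (chain_mod C n). diff C n z = \<zero>\<^bsub>chain_mod C (n - 1)\<^esub>}"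

definition boundaries :: "('r, 'c) chain_complex \<Rightarrow> int \<Rightarrow> 'c set" where
  "boundaries C n = diff C (n + 1) ` carrier (chain_mod C (n + 1))"

definition homology :: "('r, 'c) chain_complex \<Rightarrow> int \<Rightarrow> ('r, 'c set) module" where
  "homology C n = quotient_module (chain_mod C n\<lparr>carrier := cycles C n\<rparr>) (boundaries C n)"

text \<open>The increasing filtration with \<open>F\<^sub>-\<^sub>n = x^n \<cdot> C\<close> for \<open>n \<ge> 0\<close> and \<open>F\<^sub>p = C\<close> for \<open>p \<ge> 0\<close>.\<close>

definition filt :: "('r::comm_ring_1, 'c) chain_complex \<Rightarrow> 'r \<Rightarrow> int \<Rightarrow> int \<Rightarrow> 'c set" where
  "filt C x p n = (\<lambda>z. x ^ nat (- p) \<odot>\<^bsub>chain_mod C n\<^esub> z) ` carrier (chain_mod C n)"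

definition filt_complex :: "('r::comm_ring_1, 'c) chain_complex \<Rightarrow> 'r \<Rightarrow> int \<Rightarrow> ('r, 'c) chain_complex" where
  "filt_complex C x p =
     \<lparr>chain_mod = (\<lambda>n. chain_mod C n\<lparr>carrier := filt C x p n\<rparr>), diff = diff C\<rparr>"

text \<open>The image of \<open>H\<^sub>q(F^s C) \<rightarrow> H\<^sub>q(C)\<close>.\<close>

definition homology_filtration ::
  "('r::comm_ring_1, 'c) chain_complex \<Rightarrow> 'r \<Rightarrow> nat \<Rightarrow> int \<Rightarrow> 'c set set" where
  "homology_filtration C x s q =
     coset_map (chain_mod C q) (boundaries C q) (\<lambda>z. z) ` carrier (homology (filt_complex C x (- int s)) q)"

text \<open>The classical construction of the pages,
  \<open>E^r\<^sub>p\<^sub>,\<^sub>q = Z^r\<^sub>p\<^sub>,\<^sub>q / (Z^(r-1)\<^sub>p\<^sub>-\<^sub>1\<^sub>,\<^sub>q\<^sub>+\<^sub>1 + d Z^(r-1)\<^sub>p\<^sub>+\<^sub>r\<^sub>-\<^sub>1\<^sub>,\<^sub>q\<^sub>-\<^sub>r\<^sub>+\<^sub>2)\<close>. The last argument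
  of \<open>ss_cycles\<close> and \<open>ss_boundaries\<close> is the total degree \<open>p + q\<close>. For \<open>r = 0\<close> this is \<open>F\<^sub>p / F\<^sub>p\<^sub>-\<^sub>1\<close>.\<close>

definition ss_cycles ::
  "('r::comm_ring_1, 'c) chain_complex \<Rightarrow> 'r \<Rightarrow> int \<Rightarrow> int \<Rightarrow> int \<Rightarrow> 'c set" where
  "ss_cycles C x r p n = {z \<in> filt C x p n. diff C n z \<in> filt C x (p - r) (n - 1)}"

definition ss_boundaries ::
  "('r::comm_ring_1, 'c) chain_complex \<Rightarrow> 'r \<Rightarrow> int \<Rightarrow> int \<Rightarrow> int \<Rightarrow> 'c set" where
  "ss_boundaries C x r p n =
     ss_cycles C x (r - 1) (p - 1) n
       <+>\<^bsub>chain_mod C n\<^esub> diff C (n + 1) ` ss_cycles C x (r - 1) (p + r - 1) (n + 1)"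

definition ss_page ::
  "('r::comm_ring_1, 'c) chain_complex \<Rightarrow> 'r \<Rightarrow> nat \<Rightarrow> int \<Rightarrow> int \<Rightarrow> ('r, 'c set) module" where
  "ss_page C x r p q =
     quotient_module (chain_mod C (p + q)\<lparr>carrier := ss_cycles C x (int r) p (p + q)\<rparr>)
       (ss_boundaries C x (int r) p (p + q))"

text \<open>The direct sum over \<open>s \<ge> 0\<close> of the \<open>E^r\<close>-terms in filtration degree \<open>-s\<close> and total degree \<open>q\<close>, as
  a module over \<open>gr(R) = k[x]\<close>: the monomial \<open>c x^n\<close> sends the class of \<open>z\<close> in filtration degree \<open>-s\<close>
  to the class of \<open>\<epsilon>(c) x^n z\<close> in filtration degree \<open>-(s + n)\<close>, where \<open>\<epsilon>\<close> is the structure map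
  \<open>k \<rightarrow> R\<close>.\<close>

definition graded_page ::
  "('k::comm_ring_1 \<Rightarrow> 'r::comm_ring_1) \<Rightarrow> ('r, 'c) chain_complex \<Rightarrow> 'r \<Rightarrow> nat \<Rightarrow> int \<Rightarrow>
     ('k poly, nat \<Rightarrow> 'c set) module" where
  "graded_page \<epsilon> C x r q =
     (let E = (\<lambda>s::nat. ss_page C x r (- int s) (int s + q)) in
      \<lparr>carrier = {m. (\<forall>s. m s \<in> carrier (E s)) \<and> finite {s. m s \<noteq> \<zero>\<^bsub>E s\<^esub>}},
       monoid.mult = undefined, one = undefined,
       zero = (\<lambda>s. \<zero>\<^bsub>E s\<^esub>), add = (\<lambda>m m' s. m s \<oplus>\<^bsub>E s\<^esub> m' s),
       module.smult = (\<lambda>f m s. \<Oplus>\<^bsub>E s\<^esub>n\<in>{..s}.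
          coset_map (chain_mod C q) (ss_boundaries C x (int r) (- int s) q)
            (\<lambda>z. (\<epsilon> (poly.coeff f n) * x ^ n) \<odot>\<^bsub>chain_mod C q\<^esub> z) (m (s - n)))\<rparr>)"

definition graded_page_degree_zero ::
  "('k::comm_ring_1 \<Rightarrow> 'r::comm_ring_1) \<Rightarrow> ('r, 'c) chain_complex \<Rightarrow> 'r \<Rightarrow> nat \<Rightarrow> int \<Rightarrow>
     (nat \<Rightarrow> 'c set) set" where
  "graded_page_degree_zero \<epsilon> C x r q =
     {m \<in> carrier (graded_page \<epsilon> C x r q). \<forall>s>0. m s = \<zero>\<^bsub>graded_page \<epsilon> C x r q\<^esub> s}"

definition type_ring :: "'r::comm_ring_1 ring" where
  "type_ring = \<lparr>carrier = UNIV, monoid.mult = (*), one = 1, zero = 0, add = (+)\<rparr>"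

definition generated_submodule :: "('r::comm_ring_1, 'm) module \<Rightarrow> 'm set \<Rightarrow> 'm set" where
  "generated_submodule M S = \<Inter>{H. submodule H (type_ring :: 'r ring) M \<and> S \<subseteq> H}"


section \<open>The coefficient modules\<close>

text \<open>The Laurent polynomial ring \<open>k\<int> = k[t^\<plusminus>\<^sup>1]\<close> is \<^typ>\<open>int \<Rightarrow>\<^sub>0 'k\<close>, with \<open>t^n\<close> corresponding to
  \<^term>\<open>Poly_Mapping.single n 1\<close>.\<close>

definition laurent_const :: "'k::comm_ring_1 \<Rightarrow> (int \<Rightarrow>\<^sub>0 'k)" where
  "laurent_const c = Poly_Mapping.single 0 c"

definition laurent_x :: "int \<Rightarrow>\<^sub>0 'k::comm_ring_1" where
  "laurent_x = Poly_Mapping.single 1 1 - 1"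

definition linear_extension :: "('p \<Rightarrow> int) \<Rightarrow> ('p \<Rightarrow>\<^sub>0 'k::comm_ring_1) \<Rightarrow> (int \<Rightarrow>\<^sub>0 'k)" where
  "linear_extension \<nu> a =
     (\<Sum>g\<in>Poly_Mapping.keys a. Poly_Mapping.single (\<nu> g) (Poly_Mapping.lookup a g))"

text \<open>The completion at \<open>x = t - 1\<close> is \<open>k[[x]]\<close>, with \<open>t\<close> mapped to \<open>1 + x\<close>. In integer powers of
  \<open>1 + x\<close>, the inverse is the geometric series.\<close>

definition one_plus_x_power :: "int \<Rightarrow> 'k::comm_ring_1 fps" where
  "one_plus_x_power n =
     (if n \<ge> 0 then (1 + fps_X) ^ nat n else Abs_fps (\<lambda>j. (- 1) ^ j) ^ nat (- n))"

definition completion :: "(int \<Rightarrow>\<^sub>0 'k::comm_ring_1) \<Rightarrow> 'k fps" where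
  "completion p =
     (\<Sum>n\<in>Poly_Mapping.keys p. fps_const (Poly_Mapping.lookup p n) * one_plus_x_power n)"

end

theory Submission
  imports Defs
begin

text \<open>Since \<open>\<pi>\<close> acts freely on the cells of the universal cover, the cellular chains form a free
  \<open>k\<pi>\<close>-module, so \<open>R \<otimes> C\<^sub>n\<close> is a free \<open>R\<close>-module; as \<open>x\<close> is not a zero divisor in \<open>R\<close>, neither is it
  on \<open>R \<otimes> C\<^sub>n\<close>. Hence \<open>d (x\<^sup>s z) = x\<^sup>s d z\<close> lies in \<open>x\<^sup>s\<^sup>+\<^sup>r C\<close> iff \<open>d z\<close> lies in \<open>x\<^sup>r C\<close>, and it vanishes iff
  \<open>d z\<close> does. The first equivalence says that every \<open>r\<close>-cycle in filtration degree \<open>-s\<close> is \<open>x\<^sup>s\<close> times an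
  \<open>r\<close>-cycle in filtration degree 0, the second that every cycle in \<open>F\<^sup>s\<close> is \<open>x\<^sup>s\<close> times a cycle.\<close>

section \<open>Complexes of modules on which an element is regular\<close>

text \<open>The obstacle is the passage from free to regular. The tensor product is a quotient of
  the free abelian group on pairs \<open>(r, c)\<close> by the subgroup generated by the relators,
  and x u may lie in that subgroup in ways which say nothing visible about u. Membership is
  therefore decided by coordinates: \<open>\<Phi>\<close> sends a combination of pairs to an
  R-valued function on orbit representatives, kills every relator, and determines a tensor
  completely. The subgroup is then exactly the set where \<open>\<Phi>\<close> vanishes, and
  regularity of x on tensors becomes regularity of x in R itself.

  The two coefficient rings are treated together through three data: a structure map
  \<open>\<epsilon>\<close> from k to R, a multiplicative weight \<open>w\<close> on the fundamental
  group, and the regular element \<open>x\<close>; the group ring acts by sending a to the sum of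
  \<epsilon>(a(g)) w(g). The weights are t^\<nu>(g) and (1 + x)^\<nu>(g). As k is an arbitrary
  commutative ring, R may have zero divisors, and regularity of x has to be read off from
  coefficients.\<close>

lemma type_ring_simps [simp]:
  "carrier type_ring = UNIV" "monoid.mult type_ring = (*)" "one type_ring = 1"
  "zero type_ring = 0" "add type_ring = (+)"
  by (simp_all add: type_ring_def)

lemma cring_type_ring: "cring (type_ring :: 'r::comm_ring_1 ring)"
proof (rule cringI)
  show "abelian_group (type_ring :: 'r ring)"
    by (rule abelian_groupI) (auto simp: algebra_simps intro: exI[of _ "- _"] right_minus)
  show "Group.comm_monoid (type_ring :: 'r ring)"
    by (rule comm_monoidI) (auto simp: algebra_simps)
qed (auto simp: algebra_simps)

lemma coset_carrier_update [simp]: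
  "a_r_coset (M\<lparr>carrier := Z\<rparr>) = a_r_coset M"
  "set_add (M\<lparr>carrier := Z\<rparr>) = set_add M"
  "coset_map (M\<lparr>carrier := Z\<rparr>) = coset_map M"
  by (auto simp: a_r_coset_def r_coset_def set_add_def set_mult_def coset_map_def fun_eq_iff)

lemma quotient_module_simps [simp]:
  "carrier (quotient_module M N) = (\<lambda>z. N +>\<^bsub>M\<^esub> z) ` carrier M"
  "zero (quotient_module M N) = N"
  "add (quotient_module M N) = set_add M"
  "module.smult (quotient_module M N) r A = coset_map M N (\<lambda>z. r \<odot>\<^bsub>M\<^esub> z) A"
  by (auto simp: quotient_module_def A_RCOSETS_def RCOSETS_def a_r_coset_def coset_map_def)

text \<open>\<open>coset_map\<close> takes a union over all representatives, so it can be evaluated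
  at a single one only if all of them go to the same coset. Two representatives differ by an element
  of \<open>N\<close>, whose image lies in \<open>N'\<close>.\<close>

lemma coset_map_coset:
  assumes "abelian_subgroup N M" "abelian_subgroup N' M'" "z \<in> carrier M"
    and "f ` carrier M \<subseteq> carrier M'"
    and "\<And>u v. u \<in> carrier M \<Longrightarrow> v \<in> carrier M \<Longrightarrow> f (u \<oplus>\<^bsub>M\<^esub> v) = f u \<oplus>\<^bsub>M'\<^esub> f v"
    and "f ` N \<subseteq> N'"
  shows "coset_map M' N' f (N +>\<^bsub>M\<^esub> z) = N' +>\<^bsub>M'\<^esub> f z"
proof -
  interpret N: abelian_subgroup N M by fact
  interpret N': abelian_subgroup N' M' by fact
  have "N' +>\<^bsub>M'\<^esub> f w = N' +>\<^bsub>M'\<^esub> f z" if "w \<in> N +>\<^bsub>M\<^esub> z" for w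
  proof -
    from that obtain u where u: "u \<in> N" "w = u \<oplus>\<^bsub>M\<^esub> z"
      by (auto simp: a_r_coset_def')
    then have "f w = f u \<oplus>\<^bsub>M'\<^esub> f z" "f u \<in> N'"
      using assms by (auto simp: N.a_subset)
    then show ?thesis
      using assms(3,4) by (metis N'.a_Hcarr N'.a_coset_add_assoc N'.a_rcos_const N'.a_subset image_subset_iff)
  qed
  moreover have "z \<in> N +>\<^bsub>M\<^esub> z"
    by (simp add: N.a_rcos_self assms(3))
  ultimately show ?thesis
    unfolding coset_map_def by blast
qed

text \<open>The cosets of elements of \<open>Z\<close> form the subgroup (Z + N)/N of M/N. For a
  page, \<open>Z\<close> consists of its cycles and \<open>N\<close> of its boundaries.\<close>

lemma abelian_group_quotient_module:
  fixes M :: "('r, 'm) module"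
  assumes "abelian_group M" "additive_subgroup N M" "additive_subgroup Z M"
  shows "abelian_group (quotient_module (M\<lparr>carrier := Z\<rparr>) N)"
proof -
  interpret N: abelian_subgroup N M by (rule abelian_subgroupI3[OF assms(2,1)])
  interpret Z: additive_subgroup Z M by fact
  have Zc: "z \<in> Z \<Longrightarrow> z \<in> carrier M" for z by (rule Z.a_Hcarr)
  have z: "N = N +>\<^bsub>M\<^esub> \<zero>\<^bsub>M\<^esub>"
    using N.a_rcos_const by simp
  define Q where "Q = quotient_module (M\<lparr>carrier := Z\<rparr>) N"
  have Q: "carrier Q = (+>\<^bsub>M\<^esub>) N ` Z" "add Q = set_add M" "zero Q = N"
    by (simp_all add: Q_def)
  have "abelian_group Q"
  proof (rule abelian_groupI)
    show "\<zero>\<^bsub>Q\<^esub> \<in> carrier Q"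
      using z Z.zero_closed Q by blast
  next
    fix A assume "A \<in> carrier Q"
    then obtain a where a: "a \<in> Z" "A = N +>\<^bsub>M\<^esub> a" using Q by blast
    show "\<zero>\<^bsub>Q\<^esub> \<oplus>\<^bsub>Q\<^esub> A = A"
      using a Zc N.a_rcos_sum[of "\<zero>\<^bsub>M\<^esub>" a] z Q by simp
    show "\<exists>B\<in>carrier Q. B \<oplus>\<^bsub>Q\<^esub> A = \<zero>\<^bsub>Q\<^esub>"
      using a Zc N.a_rcos_sum[of "\<ominus>\<^bsub>M\<^esub> a" a] z Q
      by (intro bexI[of _ "N +>\<^bsub>M\<^esub> \<ominus>\<^bsub>M\<^esub> a"]) (simp_all add: N.l_neg)
    fix B assume "B \<in> carrier Q"
    then obtain b where b: "b \<in> Z" "B = N +>\<^bsub>M\<^esub> b" using Q by blast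
    show "A \<oplus>\<^bsub>Q\<^esub> B \<in> carrier Q"
      using a b Zc Q by (simp add: N.a_rcos_sum)
    show "A \<oplus>\<^bsub>Q\<^esub> B = B \<oplus>\<^bsub>Q\<^esub> A"
      using a b Zc Q by (simp add: N.a_rcos_sum N.a_comm)
    fix D assume "D \<in> carrier Q"
    then obtain d where d: "d \<in> Z" "D = N +>\<^bsub>M\<^esub> d" using Q by blast
    show "A \<oplus>\<^bsub>Q\<^esub> B \<oplus>\<^bsub>Q\<^esub> D = A \<oplus>\<^bsub>Q\<^esub> (B \<oplus>\<^bsub>Q\<^esub> D)"
      using a b d Zc Q by (simp add: N.a_rcos_sum N.a_assoc)
  qed
  then show ?thesis by (simp add: Q_def)
qed

lemma (in abelian_group) additive_subgroupI':
  assumes "H \<subseteq> carrier G" "\<zero> \<in> H" "\<And>a b. a \<in> H \<Longrightarrow> b \<in> H \<Longrightarrow> a \<oplus> b \<in> H"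
    "\<And>a. a \<in> H \<Longrightarrow> \<ominus> a \<in> H"
  shows "additive_subgroup H G"
  using assms by unfold_locales (auto simp: a_inv_def)

section \<open>Linear complexes with a regular scalar\<close>

locale regular_complex =
  fixes C :: "('r::comm_ring_1, 'c) chain_complex" and x :: 'r
  assumes module_chain: "module type_ring (chain_mod C n)"
    and diff_closed: "z \<in> carrier (chain_mod C n) \<Longrightarrow> diff C n z \<in> carrier (chain_mod C (n - 1))"
    and diff_add: "y \<in> carrier (chain_mod C n) \<Longrightarrow> z \<in> carrier (chain_mod C n) \<Longrightarrow>
      diff C n (y \<oplus>\<^bsub>chain_mod C n\<^esub> z) = diff C n y \<oplus>\<^bsub>chain_mod C (n - 1)\<^esub> diff C n z"
    and diff_smult: "z \<in> carrier (chain_mod C n) \<Longrightarrow>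
      diff C n (r \<odot>\<^bsub>chain_mod C n\<^esub> z) = r \<odot>\<^bsub>chain_mod C (n - 1)\<^esub> diff C n z"
    and regular: "z \<in> carrier (chain_mod C n) \<Longrightarrow> x \<odot>\<^bsub>chain_mod C n\<^esub> z = \<zero>\<^bsub>chain_mod C n\<^esub> \<Longrightarrow>
      z = \<zero>\<^bsub>chain_mod C n\<^esub>"
begin

sublocale M: module type_ring "chain_mod C n" for n
  by (rule module_chain)

text \<open>The general module laws speak of the operations of \<open>type_ring\<close>. This law
  and the following ones restate them with the operations of the type itself, in which powers of
  \<open>x\<close> can be computed.\<close>

lemma smult_closed': "z \<in> carrier (chain_mod C n) \<Longrightarrow> r \<odot>\<^bsub>chain_mod C n\<^esub> z \<in> carrier (chain_mod C n)"
  using M.smult_closed by simp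

lemma smult_assoc': "z \<in> carrier (chain_mod C n) \<Longrightarrow>
    r \<odot>\<^bsub>chain_mod C n\<^esub> (s \<odot>\<^bsub>chain_mod C n\<^esub> z) = (r * s) \<odot>\<^bsub>chain_mod C n\<^esub> z"
  using M.smult_assoc1 by simp

lemma smult_add': "y \<in> carrier (chain_mod C n) \<Longrightarrow> z \<in> carrier (chain_mod C n) \<Longrightarrow>
    r \<odot>\<^bsub>chain_mod C n\<^esub> (y \<oplus>\<^bsub>chain_mod C n\<^esub> z)
    = r \<odot>\<^bsub>chain_mod C n\<^esub> y \<oplus>\<^bsub>chain_mod C n\<^esub> r \<odot>\<^bsub>chain_mod C n\<^esub> z"
  using M.smult_r_distr by simp

lemma smult_minus': "z \<in> carrier (chain_mod C n) \<Longrightarrow>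
    r \<odot>\<^bsub>chain_mod C n\<^esub> (\<ominus>\<^bsub>chain_mod C n\<^esub> z) = \<ominus>\<^bsub>chain_mod C n\<^esub> (r \<odot>\<^bsub>chain_mod C n\<^esub> z)"
  using M.smult_r_minus by simp

lemma smult_zero': "r \<odot>\<^bsub>chain_mod C n\<^esub> \<zero>\<^bsub>chain_mod C n\<^esub> = \<zero>\<^bsub>chain_mod C n\<^esub>"
  using M.smult_r_null by simp

lemma zero_smult': "z \<in> carrier (chain_mod C n) \<Longrightarrow>
    0 \<odot>\<^bsub>chain_mod C n\<^esub> z = \<zero>\<^bsub>chain_mod C n\<^esub>"
  using M.smult_l_null by simp

lemma one_smult': "z \<in> carrier (chain_mod C n) \<Longrightarrow> 1 \<odot>\<^bsub>chain_mod C n\<^esub> z = z"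
  using M.smult_one by simp

lemma regular_power:
  "z \<in> carrier (chain_mod C n) \<Longrightarrow> x ^ k \<odot>\<^bsub>chain_mod C n\<^esub> z = \<zero>\<^bsub>chain_mod C n\<^esub> \<Longrightarrow>
    z = \<zero>\<^bsub>chain_mod C n\<^esub>"
proof (induction k)
  case (Suc k)
  then have "x \<odot>\<^bsub>chain_mod C n\<^esub> (x ^ k \<odot>\<^bsub>chain_mod C n\<^esub> z) = \<zero>\<^bsub>chain_mod C n\<^esub>"
    by (simp add: smult_assoc')
  with Suc show ?case
    using regular smult_closed' by blast
qed (simp add: one_smult')

lemma smult_power_inj:
  assumes "y \<in> carrier (chain_mod C n)" "z \<in> carrier (chain_mod C n)"
    "x ^ k \<odot>\<^bsub>chain_mod C n\<^esub> y = x ^ k \<odot>\<^bsub>chain_mod C n\<^esub> z"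
  shows "y = z"
proof -
  have "x ^ k \<odot>\<^bsub>chain_mod C n\<^esub> (y \<oplus>\<^bsub>chain_mod C n\<^esub> \<ominus>\<^bsub>chain_mod C n\<^esub> z) = \<zero>\<^bsub>chain_mod C n\<^esub>"
    using assms by (simp add: smult_add' smult_minus' smult_closed' M.r_neg)
  then have "y \<oplus>\<^bsub>chain_mod C n\<^esub> \<ominus>\<^bsub>chain_mod C n\<^esub> z = \<zero>\<^bsub>chain_mod C n\<^esub>"
    by (rule regular_power[rotated]) (use assms in simp)
  then have "\<ominus>\<^bsub>chain_mod C n\<^esub> (\<ominus>\<^bsub>chain_mod C n\<^esub> z) = y"
    using assms by (intro M.minus_equality) auto
  then show ?thesis
    using assms by simp
qed

lemma diff_zero: "diff C n \<zero>\<^bsub>chain_mod C n\<^esub> = \<zero>\<^bsub>chain_mod C (n - 1)\<^esub>"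
  using diff_smult[of "\<zero>\<^bsub>chain_mod C n\<^esub>" n 0] diff_closed[of "\<zero>\<^bsub>chain_mod C n\<^esub>" n]
  by (simp add: zero_smult' smult_zero')

lemma minus_eq_smult: "z \<in> carrier (chain_mod C n) \<Longrightarrow> \<ominus>\<^bsub>chain_mod C n\<^esub> z = (- 1) \<odot>\<^bsub>chain_mod C n\<^esub> z"
  using M.smult_l_distr[of "-1" 1 z n]
  by (intro M.minus_equality) (simp_all add: one_smult' zero_smult' smult_closed')

text \<open>Negatives are multiples by -1, so closure under scalars takes care of inverses.\<close>

lemma additive_subgroup_if_smult_closed:
  assumes "H \<subseteq> carrier (chain_mod C n)" "\<zero>\<^bsub>chain_mod C n\<^esub> \<in> H"
    "\<And>a b. a \<in> H \<Longrightarrow> b \<in> H \<Longrightarrow> a \<oplus>\<^bsub>chain_mod C n\<^esub> b \<in> H"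
    "\<And>r a. a \<in> H \<Longrightarrow> r \<odot>\<^bsub>chain_mod C n\<^esub> a \<in> H"
  shows "additive_subgroup H (chain_mod C n)"
  using assms minus_eq_smult by (intro M.additive_subgroupI') (auto simp: subset_iff)

lemma abelian_subgroup_chain: "additive_subgroup H (chain_mod C n) \<Longrightarrow> abelian_subgroup H (chain_mod C n)"
  by (rule abelian_subgroupI3) (auto intro: M.abelian_group_axioms)

section \<open>The filtration by powers of x, and cycles and boundaries of the pages\<close>

lemma filt_subset: "filt C x p n \<subseteq> carrier (chain_mod C n)"
  by (auto simp: filt_def smult_closed')

text \<open>The exponent \<open>nat (- p)\<close> is truncated to 0 for p \<ge> 0, so the hypothesis
  compares truncated exponents. It holds for p' = p with k = 0, which gives closure under scalars,
  and for p' = p - k, which gives multiplication by \<open>x ^ k\<close>.\<close>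

lemma filt_smult:
  assumes "z \<in> filt C x p n" "nat (- p') \<le> nat (- p) + k"
  shows "(c * x ^ k) \<odot>\<^bsub>chain_mod C n\<^esub> z \<in> filt C x p' n"
proof -
  obtain y where y: "y \<in> carrier (chain_mod C n)" "z = x ^ nat (- p) \<odot>\<^bsub>chain_mod C n\<^esub> y"
    using assms by (auto simp: filt_def)
  \<comment> \<open>The surplus power of \<open>x\<close> once \<open>x ^ nat (- p')\<close> has
    been pulled out; it is absorbed into \<open>y\<close>.\<close>
  define j where "j = nat (- p) + k - nat (- p')"
  have "x ^ k * x ^ nat (- p) = x ^ nat (- p') * x ^ j"
    using assms(2) by (simp add: j_def add.commute flip: power_add)
  then have "(c * x ^ k) \<odot>\<^bsub>chain_mod C n\<^esub> z = x ^ nat (- p') \<odot>\<^bsub>chain_mod C n\<^esub> ((c * x ^ j) \<odot>\<^bsub>chain_mod C n\<^esub> y)"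
    using y by (simp add: smult_assoc' ac_simps)
  then show ?thesis
    using y smult_closed' by (auto simp: filt_def)
qed

lemma additive_subgroup_filt: "additive_subgroup (filt C x p n) (chain_mod C n)"
proof (rule additive_subgroup_if_smult_closed)
  show "\<zero>\<^bsub>chain_mod C n\<^esub> \<in> filt C x p n"
    unfolding filt_def by (rule image_eqI[of _ _ "\<zero>\<^bsub>chain_mod C n\<^esub>"]) (auto simp: smult_zero')
  show "a \<oplus>\<^bsub>chain_mod C n\<^esub> b \<in> filt C x p n" if "a \<in> filt C x p n" "b \<in> filt C x p n" for a b
    using that unfolding filt_def by (auto simp flip: smult_add')
  show "r \<odot>\<^bsub>chain_mod C n\<^esub> a \<in> filt C x p n" if "a \<in> filt C x p n" for r a
    using filt_smult[OF that, of p 0 r] by simp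
qed (rule filt_subset)

lemma additive_subgroup_diff_image:
  assumes "additive_subgroup H (chain_mod C (n + 1))"
  shows "additive_subgroup (diff C (n + 1) ` H) (chain_mod C n)"
proof -
  interpret H: additive_subgroup H "chain_mod C (n + 1)" by fact
  have [simp]: "n + 1 - 1 = n" by simp
  have sub: "a \<in> H \<Longrightarrow> a \<in> carrier (chain_mod C (n + 1))" for a
    using H.a_subset by blast
  show ?thesis
  proof (rule M.additive_subgroupI')
    show "diff C (n + 1) ` H \<subseteq> carrier (chain_mod C n)"
      using diff_closed[of _ "n + 1"] sub by auto
    show "\<zero>\<^bsub>chain_mod C n\<^esub> \<in> diff C (n + 1) ` H"
      using diff_zero[of "n + 1"] by (intro image_eqI[OF _ H.zero_closed]) simp
    show "a \<oplus>\<^bsub>chain_mod C n\<^esub> b \<in> diff C (n + 1) ` H"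
      if "a \<in> diff C (n + 1) ` H" "b \<in> diff C (n + 1) ` H" for a b
    proof -
      from that(1) obtain h where h: "a = diff C (n + 1) h" "h \<in> H" by (rule imageE)
      from that(2) obtain k where k: "b = diff C (n + 1) k" "k \<in> H" by (rule imageE)
      from h k show ?thesis
        using diff_add[OF sub[OF h(2)] sub[OF k(2)]]
        by (intro image_eqI[OF _ H.a_closed[OF h(2) k(2)]]) simp
    qed
    show "\<ominus>\<^bsub>chain_mod C n\<^esub> a \<in> diff C (n + 1) ` H" if "a \<in> diff C (n + 1) ` H" for a
    proof -
      from that obtain h where h: "a = diff C (n + 1) h" "h \<in> H" by (rule imageE)
      then have "\<ominus>\<^bsub>chain_mod C n\<^esub> a = diff C (n + 1) (\<ominus>\<^bsub>chain_mod C (n + 1)\<^esub> h)"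
        using diff_closed[OF sub[OF h(2)]] diff_smult[OF sub[OF h(2)], of "- 1"]
        by (simp add: minus_eq_smult sub)
      then show ?thesis using H.a_inv_closed[OF h(2)] by (rule image_eqI)
    qed
  qed
qed

lemma ss_cycles_subset: "ss_cycles C x r p n \<subseteq> carrier (chain_mod C n)"
  using filt_subset by (auto simp: ss_cycles_def)

text \<open>The chain and its boundary sit in different filtration degrees, and truncation may
  affect one exponent but not the other; hence one inequality for each.\<close>

lemma ss_cycles_smult:
  assumes "z \<in> ss_cycles C x r p n" "nat (- p') \<le> nat (- p) + k"
    "nat (- (p' - r)) \<le> nat (- (p - r)) + k"
  shows "(c * x ^ k) \<odot>\<^bsub>chain_mod C n\<^esub> z \<in> ss_cycles C x r p' n"
proof -
  have z: "z \<in> filt C x p n" "diff C n z \<in> filt C x (p - r) (n - 1)" "z \<in> carrier (chain_mod C n)"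
    using assms(1) ss_cycles_subset by (auto simp: ss_cycles_def)
  then show ?thesis
    using filt_smult[OF z(1) assms(2)] filt_smult[OF z(2) assms(3)]
    by (simp add: ss_cycles_def diff_smult)
qed

lemma additive_subgroup_ss_cycles: "additive_subgroup (ss_cycles C x r p n) (chain_mod C n)"
proof (rule additive_subgroup_if_smult_closed)
  interpret F: additive_subgroup "filt C x p n" "chain_mod C n"
    by (rule additive_subgroup_filt)
  interpret F': additive_subgroup "filt C x (p - r) (n - 1)" "chain_mod C (n - 1)"
    by (rule additive_subgroup_filt)
  show "\<zero>\<^bsub>chain_mod C n\<^esub> \<in> ss_cycles C x r p n"
    by (simp add: ss_cycles_def diff_zero)
  show "a \<oplus>\<^bsub>chain_mod C n\<^esub> b \<in> ss_cycles C x r p n"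
    if "a \<in> ss_cycles C x r p n" "b \<in> ss_cycles C x r p n" for a b
    using that filt_subset by (auto simp: ss_cycles_def diff_add)
  show "s \<odot>\<^bsub>chain_mod C n\<^esub> a \<in> ss_cycles C x r p n" if "a \<in> ss_cycles C x r p n" for s a
    using ss_cycles_smult[OF that, of p 0 s] by simp
qed (rule ss_cycles_subset)

lemma additive_subgroup_ss_boundaries: "additive_subgroup (ss_boundaries C x r p n) (chain_mod C n)"
  unfolding ss_boundaries_def
  by (intro M.add_additive_subgroups additive_subgroup_ss_cycles additive_subgroup_diff_image)

text \<open>This makes multiplication by c x^k well defined on the pages. Each summand is handled by
  itself, the second one through linearity of the differential: lowering a filtration degree by k
  raises its truncated exponent by at most k, so the factor \<open>x ^ k\<close> always
  suffices.\<close>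

lemma ss_boundaries_smult:
  assumes "z \<in> ss_boundaries C x r p n" "p \<le> 0"
  shows "(c * x ^ k) \<odot>\<^bsub>chain_mod C n\<^esub> z \<in> ss_boundaries C x r (p - int k) n"
proof -
  obtain u v where u: "u \<in> ss_cycles C x (r - 1) (p - 1) n"
    and v: "v \<in> ss_cycles C x (r - 1) (p + r - 1) (n + 1)"
    and z: "z = u \<oplus>\<^bsub>chain_mod C n\<^esub> diff C (n + 1) v"
    using assms by (auto simp: ss_boundaries_def set_add_def')
  have carr: "u \<in> carrier (chain_mod C n)" "v \<in> carrier (chain_mod C (n + 1))"
    using u v ss_cycles_subset by blast+
  then have dv: "diff C (n + 1) v \<in> carrier (chain_mod C n)"
    using diff_closed[of v "n + 1"] by simp
  have "(c * x ^ k) \<odot>\<^bsub>chain_mod C n\<^esub> u \<in> ss_cycles C x (r - 1) (p - int k - 1) n"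
    using u assms(2) by (intro ss_cycles_smult) auto
  moreover have "(c * x ^ k) \<odot>\<^bsub>chain_mod C (n + 1)\<^esub> v \<in> ss_cycles C x (r - 1) (p - int k + r - 1) (n + 1)"
    using v assms(2) by (intro ss_cycles_smult) auto
  moreover have "(c * x ^ k) \<odot>\<^bsub>chain_mod C n\<^esub> z = (c * x ^ k) \<odot>\<^bsub>chain_mod C n\<^esub> u
      \<oplus>\<^bsub>chain_mod C n\<^esub> diff C (n + 1) ((c * x ^ k) \<odot>\<^bsub>chain_mod C (n + 1)\<^esub> v)"
    using diff_smult[OF carr(2)] carr dv by (simp add: z smult_add')
  ultimately show ?thesis
    by (auto simp: ss_boundaries_def set_add_def')
qed

lemma ss_cycles_divide:
  assumes "w \<in> ss_cycles C x (int r) (- int s) n"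
  obtains z where "z \<in> ss_cycles C x (int r) 0 n" "w = x ^ s \<odot>\<^bsub>chain_mod C n\<^esub> z"
proof -
  from assms obtain z y where z: "z \<in> carrier (chain_mod C n)" "w = x ^ s \<odot>\<^bsub>chain_mod C n\<^esub> z"
    and y: "y \<in> carrier (chain_mod C (n - 1))"
      "diff C n w = x ^ nat (int s + int r) \<odot>\<^bsub>chain_mod C (n - 1)\<^esub> y"
    by (auto simp: ss_cycles_def filt_def add.commute)
  \<comment> \<open>Neither s nor s + r is negative, so no exponent is truncated and
    \<open>x ^ nat (int s + int r)\<close> splits off the factor \<open>x ^ s\<close> that is
    cancelled next.\<close>
  have "x ^ s \<odot>\<^bsub>chain_mod C (n - 1)\<^esub> diff C n z
      = x ^ s \<odot>\<^bsub>chain_mod C (n - 1)\<^esub> (x ^ r \<odot>\<^bsub>chain_mod C (n - 1)\<^esub> y)"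
    using z y by (simp add: diff_smult smult_assoc' nat_add_distrib power_add)
  then have "diff C n z = x ^ r \<odot>\<^bsub>chain_mod C (n - 1)\<^esub> y"
    by (rule smult_power_inj[rotated 2]) (simp_all add: z y diff_closed smult_closed')
  then have "z \<in> ss_cycles C x (int r) 0 n"
    using z(1) y(1) by (auto simp: ss_cycles_def filt_def one_smult')
  with z that show ?thesis by blast
qed

lemma additive_subgroup_boundaries: "additive_subgroup (boundaries C n) (chain_mod C n)"
proof -
  have "additive_subgroup (carrier (chain_mod C (n + 1))) (chain_mod C (n + 1))"
    by (rule M.additive_subgroupI') auto
  then show ?thesis
    unfolding boundaries_def by (rule additive_subgroup_diff_image)
qed

text \<open>Both sides consist of the cosets of x^s z modulo all boundaries, with z a cycle of C.
  The map on the left only enlarges cosets modulo boundaries of the subcomplex to cosets modulo all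
  boundaries; the one on the right is well defined because x^s preserves boundaries.\<close>

theorem homology_filtration_eq:
  "homology_filtration C x s q
   = (\<lambda>h. x ^ s \<odot>\<^bsub>homology C q\<^esub> h) ` carrier (homology C q)"
proof -
  let ?M = "chain_mod C q"
  let ?B = "boundaries C q"
  let ?F = "filt_complex C x (- int s)"
  have B: "abelian_subgroup ?B ?M"
    by (intro abelian_subgroup_chain additive_subgroup_boundaries)
  have Bs: "abelian_subgroup (boundaries ?F q) ?M"
    using additive_subgroup_diff_image[OF additive_subgroup_filt]
    by (auto intro: abelian_subgroup_chain simp: boundaries_def filt_complex_def)
  have Bsub: "boundaries ?F q \<subseteq> ?B"
    using filt_subset by (auto simp: boundaries_def filt_complex_def)
  have xB: "(\<lambda>z. x ^ s \<odot>\<^bsub>?M\<^esub> z) ` ?B \<subseteq> ?B"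
  proof safe
    fix z assume "z \<in> ?B"
    then obtain y where y: "y \<in> carrier (chain_mod C (q + 1))" "z = diff C (q + 1) y"
      by (auto simp: boundaries_def)
    then have "x ^ s \<odot>\<^bsub>?M\<^esub> z = diff C (q + 1) (x ^ s \<odot>\<^bsub>chain_mod C (q + 1)\<^esub> y)"
      using diff_smult[OF y(1)] by simp
    then show "x ^ s \<odot>\<^bsub>?M\<^esub> z \<in> ?B"
      using y smult_closed' by (auto simp: boundaries_def)
  qed
  have cyc: "cycles ?F q = (\<lambda>z. x ^ s \<odot>\<^bsub>?M\<^esub> z) ` cycles C q"
  proof safe
    fix w assume "w \<in> cycles ?F q"
    then obtain z where z: "z \<in> carrier ?M" "w = x ^ s \<odot>\<^bsub>?M\<^esub> z"
      and dw: "diff C q w = \<zero>\<^bsub>chain_mod C (q - 1)\<^esub>"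
      by (auto simp: cycles_def filt_complex_def filt_def)
    then have "diff C q z = \<zero>\<^bsub>chain_mod C (q - 1)\<^esub>"
      using regular_power[of "diff C q z" "q - 1" s] by (simp add: diff_smult diff_closed)
    with z show "w \<in> (\<lambda>z. x ^ s \<odot>\<^bsub>?M\<^esub> z) ` cycles C q"
      by (auto simp: cycles_def)
  qed (auto simp: cycles_def filt_complex_def filt_def diff_smult smult_zero')
  have carr: "cycles C q \<subseteq> carrier ?M"
    by (auto simp: cycles_def)
  have "homology_filtration C x s q
      = coset_map ?M ?B (\<lambda>z. z) ` (\<lambda>z. boundaries ?F q +>\<^bsub>?M\<^esub> z) ` cycles ?F q"
    unfolding homology_filtration_def homology_def
    by (simp add: filt_complex_def)
  also have "\<dots> = (\<lambda>z. ?B +>\<^bsub>?M\<^esub> x ^ s \<odot>\<^bsub>?M\<^esub> z) ` cycles C q"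
    unfolding cyc image_image
  proof (rule image_cong[OF refl])
    fix z assume "z \<in> cycles C q"
    then show "coset_map ?M ?B (\<lambda>z. z) (boundaries ?F q +>\<^bsub>?M\<^esub> (x ^ s \<odot>\<^bsub>?M\<^esub> z)) = ?B +>\<^bsub>?M\<^esub> x ^ s \<odot>\<^bsub>?M\<^esub> z"
      using carr Bsub by (intro coset_map_coset[OF Bs B]) (auto simp: smult_closed')
  qed
  also have "\<dots> = coset_map ?M ?B (\<lambda>z. x ^ s \<odot>\<^bsub>?M\<^esub> z) ` (\<lambda>z. ?B +>\<^bsub>?M\<^esub> z) ` cycles C q"
    unfolding image_image
  proof (rule image_cong[OF refl])
    fix z assume "z \<in> cycles C q"
    then show "?B +>\<^bsub>?M\<^esub> x ^ s \<odot>\<^bsub>?M\<^esub> z = coset_map ?M ?B (\<lambda>z. x ^ s \<odot>\<^bsub>?M\<^esub> z) (?B +>\<^bsub>?M\<^esub> z)"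
      using carr xB by (intro coset_map_coset[OF B B, symmetric]) (auto simp: smult_closed' smult_add')
  qed
  finally show ?thesis
    unfolding homology_def by simp
qed

section \<open>The graded page and its generation in degree zero\<close>

text \<open>The summand of index \<open>s\<close> in \<open>graded_page\<close> is the page in
  bidegree (-s, s + q); here the total degree is already simplified to \<open>q\<close>.\<close>

definition page :: "nat \<Rightarrow> int \<Rightarrow> nat \<Rightarrow> ('r, 'c set) module" where
  "page r q s = quotient_module (chain_mod C q\<lparr>carrier := ss_cycles C x (int r) (- int s) q\<rparr>)
     (ss_boundaries C x (int r) (- int s) q)"

lemma page_simps:
  "carrier (page r q s) = (\<lambda>z. ss_boundaries C x (int r) (- int s) q +>\<^bsub>chain_mod C q\<^esub> z) `
     ss_cycles C x (int r) (- int s) q"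
  "zero (page r q s) = ss_boundaries C x (int r) (- int s) q"
  "add (page r q s) = set_add (chain_mod C q)"
  by (simp_all add: page_def)

lemma abelian_group_page: "abelian_group (page r q s)"
  unfolding page_def
  by (intro abelian_group_quotient_module additive_subgroup_ss_boundaries additive_subgroup_ss_cycles
      M.abelian_group_axioms)

text \<open>The action of c x^n from the summand s - n into the summand \<open>s\<close>. It is
  indexed by its target because the scalar product in \<open>graded_page\<close> is a convolution
  computed separately for each target.\<close>

definition page_smult :: "nat \<Rightarrow> int \<Rightarrow> nat \<Rightarrow> nat \<Rightarrow> 'r \<Rightarrow> 'c set \<Rightarrow> 'c set" where
  "page_smult r q s n c = coset_map (chain_mod C q) (ss_boundaries C x (int r) (- int s) q)
     (\<lambda>z. (c * x ^ n) \<odot>\<^bsub>chain_mod C q\<^esub> z)"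

lemma page_smult_coset:
  assumes "n \<le> s" "z \<in> carrier (chain_mod C q)"
  shows "page_smult r q s n c (ss_boundaries C x (int r) (- int (s - n)) q +>\<^bsub>chain_mod C q\<^esub> z)
    = ss_boundaries C x (int r) (- int s) q +>\<^bsub>chain_mod C q\<^esub> ((c * x ^ n) \<odot>\<^bsub>chain_mod C q\<^esub> z)"
  unfolding page_smult_def
proof (rule coset_map_coset)
  \<comment> \<open>The bound n \<le> s makes the subtraction of naturals exact, so that
    \<open>x ^ n\<close> leads from filtration degree -(s - n) to exactly -s.\<close>
  have "- int (s - n) - int n = - int s"
    using assms(1) by simp
  then show "(\<lambda>z. (c * x ^ n) \<odot>\<^bsub>chain_mod C q\<^esub> z) ` ss_boundaries C x (int r) (- int (s - n)) q
      \<subseteq> ss_boundaries C x (int r) (- int s) q"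
    using ss_boundaries_smult[of _ "int r" "- int (s - n)" q c n] by fastforce
  show "(\<lambda>z. (c * x ^ n) \<odot>\<^bsub>chain_mod C q\<^esub> z) ` carrier (chain_mod C q) \<subseteq> carrier (chain_mod C q)"
    using smult_closed' by fast
qed (simp_all add: assms smult_add' abelian_subgroup_chain additive_subgroup_ss_boundaries)

text \<open>The zero of a page is the group of boundaries itself; as the coset of 0 it falls under
  the formula for cosets.\<close>

lemma page_zero: "ss_boundaries C x r p q = ss_boundaries C x r p q +>\<^bsub>chain_mod C q\<^esub> \<zero>\<^bsub>chain_mod C q\<^esub>"
  by (rule abelian_subgroup.a_rcos_const[symmetric])
    (simp_all add: abelian_subgroup_chain additive_subgroup_ss_boundaries
      additive_subgroup.zero_closed[OF additive_subgroup_ss_boundaries])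

lemma page_smult_closed:
  assumes "n \<le> s" "A \<in> carrier (page r q (s - n))"
  shows "page_smult r q s n c A \<in> carrier (page r q s)"
proof -
  obtain z where z: "z \<in> ss_cycles C x (int r) (- int (s - n)) q"
    and A: "A = ss_boundaries C x (int r) (- int (s - n)) q +>\<^bsub>chain_mod C q\<^esub> z"
    using assms(2) unfolding page_simps by fast
  have "(c * x ^ n) \<odot>\<^bsub>chain_mod C q\<^esub> z \<in> ss_cycles C x (int r) (- int s) q"
    using z by (rule ss_cycles_smult) (use assms(1) in auto)
  then show ?thesis
    using z ss_cycles_subset unfolding A page_simps
    by (subst page_smult_coset[OF assms(1)]) fast+
qed

lemma page_smult_zero:
  assumes "n \<le> s"
  shows "page_smult r q s n c (zero (page r q (s - n))) = zero (page r q s)"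
proof -
  have "page_smult r q s n c (ss_boundaries C x (int r) (- int (s - n)) q +>\<^bsub>chain_mod C q\<^esub> \<zero>\<^bsub>chain_mod C q\<^esub>)
      = ss_boundaries C x (int r) (- int s) q +>\<^bsub>chain_mod C q\<^esub> \<zero>\<^bsub>chain_mod C q\<^esub>"
    using page_smult_coset[OF assms M.zero_closed] by (simp only: smult_zero')
  then show ?thesis
    by (simp only: page_simps page_zero[symmetric])
qed

lemma page_zero_smult:
  assumes "n \<le> s" "A \<in> carrier (page r q (s - n))"
  shows "page_smult r q s n 0 A = zero (page r q s)"
proof -
  obtain z where z: "z \<in> ss_cycles C x (int r) (- int (s - n)) q"
    and A: "A = ss_boundaries C x (int r) (- int (s - n)) q +>\<^bsub>chain_mod C q\<^esub> z"
    using assms(2) unfolding page_simps by fast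
  have "z \<in> carrier (chain_mod C q)"
    using z ss_cycles_subset by fast
  then show ?thesis
    by (simp only: A page_smult_coset[OF assms(1)] mult_zero_left zero_smult' page_simps
        page_zero[symmetric])
qed

lemma graded_page_simps:
  "carrier (graded_page \<epsilon> C x r q)
   = {m. (\<forall>s. m s \<in> carrier (page r q s)) \<and> finite {s. m s \<noteq> zero (page r q s)}}"
  "zero (graded_page \<epsilon> C x r q) = (\<lambda>s. zero (page r q s))"
  "add (graded_page \<epsilon> C x r q) = (\<lambda>m m' s. m s \<oplus>\<^bsub>page r q s\<^esub> m' s)"
  "module.smult (graded_page \<epsilon> C x r q) f m
   = (\<lambda>s. \<Oplus>\<^bsub>page r q s\<^esub>n\<in>{..s}. page_smult r q s n (\<epsilon> (poly.coeff f n)) (m (s - n)))"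
  by (simp_all add: graded_page_def ss_page_def page_def page_smult_def Let_def)

text \<open>A term of the convolution vanishes as soon as one of its two factors does. This serves
  both the finiteness of supports and the computation of products with monomials.\<close>

lemma page_smult_finsum_zero:
  assumes "\<epsilon> 0 = 0" "\<And>s. m s \<in> carrier (page r q s)"
    "\<And>n. n \<le> s \<Longrightarrow> poly.coeff f n = 0 \<or> m (s - n) = zero (page r q (s - n))"
  shows "(\<Oplus>\<^bsub>page r q s\<^esub>n\<in>{..s}. page_smult r q s n (\<epsilon> (poly.coeff f n)) (m (s - n))) = zero (page r q s)"
proof -
  interpret E: abelian_group "page r q s" by (rule abelian_group_page)
  have "page_smult r q s n (\<epsilon> (poly.coeff f n)) (m (s - n)) = zero (page r q s)" if "n \<in> {..s}" for n
    using assms(3)[of n] that by (auto simp: assms(1,2) page_smult_zero page_zero_smult)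
  then have "(\<Oplus>\<^bsub>page r q s\<^esub>n\<in>{..s}. page_smult r q s n (\<epsilon> (poly.coeff f n)) (m (s - n)))
      = (\<Oplus>\<^bsub>page r q s\<^esub>n\<in>{..s}. zero (page r q s))"
    by (intro E.finsum_cong') auto
  then show ?thesis by simp
qed

lemma abelian_group_graded_page: "abelian_group (graded_page \<epsilon> C x r q)"
proof (rule abelian_groupI)
  let ?G = "graded_page \<epsilon> C x r q"
  interpret E: abelian_group "page r q i" for i by (rule abelian_group_page)
  show "\<zero>\<^bsub>?G\<^esub> \<in> carrier ?G"
    by (simp add: graded_page_simps)
  fix m assume m: "m \<in> carrier ?G"
  have m': "m s \<in> carrier (page r q s)" for s
    using m by (simp add: graded_page_simps)
  show "\<zero>\<^bsub>?G\<^esub> \<oplus>\<^bsub>?G\<^esub> m = m"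
    by (simp add: graded_page_simps m')
  show "\<exists>y\<in>carrier ?G. y \<oplus>\<^bsub>?G\<^esub> m = \<zero>\<^bsub>?G\<^esub>"
  proof
    have "finite {s. \<ominus>\<^bsub>page r q s\<^esub> m s \<noteq> zero (page r q s)}"
      by (rule finite_subset[of _ "{s. m s \<noteq> zero (page r q s)}"])
        (use m in \<open>auto simp: graded_page_simps\<close>)
    then show "(\<lambda>s. \<ominus>\<^bsub>page r q s\<^esub> m s) \<in> carrier ?G"
      by (simp add: graded_page_simps m')
    show "(\<lambda>s. \<ominus>\<^bsub>page r q s\<^esub> m s) \<oplus>\<^bsub>?G\<^esub> m = \<zero>\<^bsub>?G\<^esub>"
      by (simp add: graded_page_simps m' E.l_neg)
  qed
  fix n assume n: "n \<in> carrier ?G"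
  have n': "n s \<in> carrier (page r q s)" for s
    using n by (simp add: graded_page_simps)
  have "finite {s. m s \<oplus>\<^bsub>page r q s\<^esub> n s \<noteq> zero (page r q s)}"
    by (rule finite_subset[of _ "{s. m s \<noteq> zero (page r q s)} \<union> {s. n s \<noteq> zero (page r q s)}"])
      (use m n in \<open>auto simp: graded_page_simps\<close>)
  then show "m \<oplus>\<^bsub>?G\<^esub> n \<in> carrier ?G"
    by (simp add: graded_page_simps m' n')
  show "m \<oplus>\<^bsub>?G\<^esub> n = n \<oplus>\<^bsub>?G\<^esub> m"
    by (simp add: graded_page_simps m' n' E.a_comm)
  fix l assume l: "l \<in> carrier ?G"
  have l': "l s \<in> carrier (page r q s)" for s
    using l by (simp add: graded_page_simps)
  show "m \<oplus>\<^bsub>?G\<^esub> n \<oplus>\<^bsub>?G\<^esub> l = m \<oplus>\<^bsub>?G\<^esub> (n \<oplus>\<^bsub>?G\<^esub> l)"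
    by (simp add: graded_page_simps m' n' l' E.a_assoc)
qed

text \<open>\<open>generated_submodule\<close> is an intersection of submodules, and it stays inside
  the carrier because the carrier is one of them. The point to check is finite support: a product is
  supported on sums of an exponent of \<open>f\<close> and an index in the support of
  \<open>m\<close>.\<close>

lemma submodule_carrier_graded_page:
  assumes "\<epsilon> 0 = 0"
  shows "submodule (carrier (graded_page \<epsilon> C x r q)) type_ring (graded_page \<epsilon> C x r q)"
proof -
  let ?G = "graded_page \<epsilon> C x r q"
  interpret G: abelian_group ?G by (rule abelian_group_graded_page)
  interpret E: abelian_group "page r q i" for i by (rule abelian_group_page)
  have "f \<odot>\<^bsub>?G\<^esub> m \<in> carrier ?G" if "m \<in> carrier ?G" for f m
  proof -
    have m: "m s \<in> carrier (page r q s)" for s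
      using that by (simp add: graded_page_simps)
    have fin: "finite {s. m s \<noteq> zero (page r q s)}"
      using that by (simp add: graded_page_simps)
    have "finite {n. poly.coeff f n \<noteq> 0}"
      using MOST_coeff_eq_0[of f] by (simp add: eventually_cofinite)
    with fin have "finite ((\<lambda>(a, b). a + b) ` ({n. poly.coeff f n \<noteq> 0} \<times> {s. m s \<noteq> zero (page r q s)}))"
      by simp
    moreover have "(f \<odot>\<^bsub>?G\<^esub> m) s = zero (page r q s)"
      if s: "s \<notin> (\<lambda>(a, b). a + b) ` ({n. poly.coeff f n \<noteq> 0} \<times> {s. m s \<noteq> zero (page r q s)})" for s
    proof -
      have "poly.coeff f n = 0 \<or> m (s - n) = zero (page r q (s - n))" if "n \<le> s" for n
      proof (rule ccontr)
        assume "\<not> ?thesis"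
        then show False
          using s that by (auto intro!: image_eqI[of _ _ "(n, s - n)"])
      qed
      then show ?thesis
        using page_smult_finsum_zero[of \<epsilon> m r q s f] assms m by (simp add: graded_page_simps)
    qed
    ultimately have "finite {s. (f \<odot>\<^bsub>?G\<^esub> m) s \<noteq> zero (page r q s)}"
      by (elim finite_subset[rotated]) blast
    moreover have "(f \<odot>\<^bsub>?G\<^esub> m) s \<in> carrier (page r q s)" for s
      unfolding graded_page_simps by (rule E.finsum_closed) (simp add: page_smult_closed m)
    ultimately show ?thesis
      by (simp add: graded_page_simps)
  qed
  then show ?thesis
    by (intro submodule.intro submodule_axioms.intro)
      (use G.add.subgroup_self in simp_all)
qed

text \<open>A class in degree \<open>s\<close> is represented by \<open>x ^ s z\<close> with \<open>z\<close> in filtration degree 0, hence it is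
  \<open>x ^ s\<close> times the class of \<open>z\<close>.\<close>

lemma homogeneous_in_submodule:
  assumes \<epsilon>: "\<epsilon> 0 = 0" "\<epsilon> 1 = 1"
    and H: "submodule H type_ring (graded_page \<epsilon> C x r q)"
      "graded_page_degree_zero \<epsilon> C x r q \<subseteq> H"
    and A: "A \<in> carrier (page r q s)"
  shows "(\<lambda>j. zero (page r q j))(s := A) \<in> H"
proof -
  let ?G = "graded_page \<epsilon> C x r q"
  obtain w where w: "w \<in> ss_cycles C x (int r) (- int s) q"
    and A_eq: "A = ss_boundaries C x (int r) (- int s) q +>\<^bsub>chain_mod C q\<^esub> w"
    using A unfolding page_simps by fast
  obtain z where z: "z \<in> ss_cycles C x (int r) 0 q" "w = x ^ s \<odot>\<^bsub>chain_mod C q\<^esub> z"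
    using ss_cycles_divide[OF w] .
  interpret E: abelian_group "page r q i" for i by (rule abelian_group_page)
  define B where "B = ss_boundaries C x (int r) 0 q +>\<^bsub>chain_mod C q\<^esub> z"
  define e where "e = (\<lambda>j. zero (page r q j))(0 := B)"
  have B: "B \<in> carrier (page r q 0)"
    using z by (simp add: B_def page_simps)
  have zc: "z \<in> carrier (chain_mod C q)"
    using z(1) ss_cycles_subset by fast
  have e: "e j \<in> carrier (page r q j)" for j
    using B by (simp add: e_def)
  have "finite {j. e j \<noteq> zero (page r q j)}"
    by (rule finite_subset[of _ "{0}"]) (auto simp: e_def)
  with e have "e \<in> carrier ?G"
    by (simp add: graded_page_simps)
  then have "e \<in> graded_page_degree_zero \<epsilon> C x r q"
    by (simp add: graded_page_degree_zero_def graded_page_simps(2) e_def)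
  then have "e \<in> H"
    using H(2) by fast
  then have mem: "monom 1 s \<odot>\<^bsub>?G\<^esub> e \<in> H"
    by (intro submodule.smult_closed[OF H(1)]) simp_all
  have "(monom 1 s \<odot>\<^bsub>?G\<^esub> e) j = ((\<lambda>j. zero (page r q j))(s := A)) j" for j
  proof (cases "j = s")
    case False
    \<comment> \<open>The coefficient at n is nonzero only for n = s, and the component of
      \<open>e\<close> at j - n only for n = j; both at once would force j = s.\<close>
    then have "(monom 1 s \<odot>\<^bsub>?G\<^esub> e) j = zero (page r q j)"
      unfolding graded_page_simps
      by (intro page_smult_finsum_zero \<epsilon> e) (auto simp: e_def)
    with False show ?thesis by simp
  next
    case True
    have "(monom 1 s \<odot>\<^bsub>?G\<^esub> e) s
        = (\<Oplus>\<^bsub>page r q s\<^esub>n\<in>{..s}. if s = n then page_smult r q s s 1 B else zero (page r q s))"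
      unfolding graded_page_simps
    proof (rule E.finsum_cong')
      show "(\<lambda>n. if s = n then page_smult r q s s 1 B else zero (page r q s)) \<in> {..s} \<rightarrow> carrier (page r q s)"
        using page_smult_closed[of s s B r q 1] B by (simp add: Pi_def)
    qed (use e in \<open>auto simp: \<epsilon> page_zero_smult e_def\<close>)
    also have "\<dots> = page_smult r q s s 1 B"
      using page_smult_closed[of s s B r q 1] B by (intro E.finsum_singleton) auto
    also have "\<dots> = A"
      using page_smult_coset[OF le_refl zc, of r s 1]
      by (simp add: B_def A_eq z(2))
    finally show ?thesis
      using True by simp
  qed
  then have "monom 1 s \<odot>\<^bsub>?G\<^esub> e = (\<lambda>j. zero (page r q j))(s := A)" by (rule ext)
  with mem show ?thesis by simp
qed

text \<open>An element of the direct sum is a finite sum of homogeneous ones, so a submodule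
  containing all homogeneous elements is everything.\<close>

theorem graded_page_generated_in_degree_zero:
  assumes \<epsilon>: "\<epsilon> 0 = 0" "\<epsilon> 1 = 1"
  shows "generated_submodule (graded_page \<epsilon> C x r q) (graded_page_degree_zero \<epsilon> C x r q)
    = carrier (graded_page \<epsilon> C x r q)"
proof
  let ?G = "graded_page \<epsilon> C x r q"
  let ?S = "graded_page_degree_zero \<epsilon> C x r q"
  interpret E: abelian_group "page r q i" for i by (rule abelian_group_page)
  have "?S \<subseteq> carrier ?G"
    by (auto simp: graded_page_degree_zero_def)
  then show "generated_submodule ?G ?S \<subseteq> carrier ?G"
    unfolding generated_submodule_def using submodule_carrier_graded_page[of \<epsilon> r q] \<epsilon> by fast
  show "carrier ?G \<subseteq> generated_submodule ?G ?S"
    unfolding generated_submodule_def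
  proof (intro subsetI InterI)
    fix m H assume m: "m \<in> carrier ?G" and "H \<in> {H. submodule H type_ring ?G \<and> ?S \<subseteq> H}"
    then have H: "submodule H type_ring ?G" "?S \<subseteq> H" by simp_all
    \<comment> \<open>Any finite \<open>F\<close> containing the support is allowed, so erasing one
      component of \<open>m\<close> leaves an element covered by the smaller set.\<close>
    have "m \<in> H" if "finite F" "m \<in> carrier ?G" "{s. m s \<noteq> zero (page r q s)} \<subseteq> F" for F m
      using that
    proof (induction F arbitrary: m)
      case empty
      then have "m = \<zero>\<^bsub>?G\<^esub>"
        by (auto simp: graded_page_simps)
      then show ?case
        using subgroup.one_closed[OF submodule.axioms(1)[OF H(1)]] by simp
    next
      case (insert s F)
      have m: "m j \<in> carrier (page r q j)" for j
        using insert.prems(1) by (simp add: graded_page_simps)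
      let ?m' = "m(s := zero (page r q s))"
      let ?h = "(\<lambda>j. zero (page r q j))(s := m s)"
      have "{j. ?m' j \<noteq> zero (page r q j)} \<subseteq> F"
        using insert.prems(2) by auto
      moreover from this have "?m' \<in> carrier ?G"
        using m finite_subset[OF _ insert.hyps(1)] by (simp add: graded_page_simps)
      ultimately have "?m' \<in> H"
        by (intro insert.IH)
      moreover have "?h \<in> H"
        by (intro homogeneous_in_submodule[OF \<epsilon> H] m)
      ultimately have "?m' \<oplus>\<^bsub>?G\<^esub> ?h \<in> H"
        using subgroup.m_closed[OF submodule.axioms(1)[OF H(1)], of ?m' ?h] by simp
      also have "?m' \<oplus>\<^bsub>?G\<^esub> ?h = m"
        by (auto simp: graded_page_simps m fun_eq_iff)
      finally show ?case .
    qed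
    from this[OF _ m subset_refl] show "m \<in> H"
      using m by (simp add: graded_page_simps)
  qed
qed

end

section \<open>Tensor products with free permutation modules\<close>

lemma pairs_module_simps [simp]:
  "carrier (pairs_module C) = {u. Poly_Mapping.keys u \<subseteq> UNIV \<times> C}"
  "zero (pairs_module C) = 0" "add (pairs_module C) = (+)"
  "module.smult (pairs_module C) r = frag_extend (\<lambda>(s, c). frag_of (r * s, c))"
  by (simp_all add: pairs_module_def)

lemma abelian_group_pairs_module: "abelian_group (pairs_module C)"
proof (rule abelian_groupI)
  show "\<exists>y\<in>carrier (pairs_module C). y \<oplus>\<^bsub>pairs_module C\<^esub> u = \<zero>\<^bsub>pairs_module C\<^esub>"
    if "u \<in> carrier (pairs_module C)" for u
    using that by (intro bexI[of _ "- u"]) auto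
qed (use keys_add in \<open>fastforce simp: algebra_simps\<close>)+

lemma a_inv_pairs_module:
  assumes "u \<in> carrier (pairs_module C)"
  shows "\<ominus>\<^bsub>pairs_module C\<^esub> u = - u"
  by (rule abelian_group.minus_equality[OF abelian_group_pairs_module]) (use assms in simp_all)

section \<open>The relator subgroup and the module structure on its cosets\<close>

locale tensor_product =
  fixes \<rho> :: "'p \<Rightarrow> 'r::comm_ring_1" and P :: "'p set" and C :: "'c::ab_group_add set"
    and act :: "'p \<Rightarrow> 'c \<Rightarrow> 'c"
  assumes C_add: "c \<in> C \<Longrightarrow> d \<in> C \<Longrightarrow> c + d \<in> C"
    and act_closed: "a \<in> P \<Longrightarrow> c \<in> C \<Longrightarrow> act a c \<in> C"
begin

abbreviation pairs :: "('r, 'r \<times> 'c \<Rightarrow>\<^sub>0 int) module" where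
  "pairs \<equiv> pairs_module C"

abbreviation kernel :: "('r \<times> 'c \<Rightarrow>\<^sub>0 int) set" where
  "kernel \<equiv> tensor_kernel \<rho> P C act"

lemma relators_subset: "tensor_relators \<rho> P C act \<subseteq> carrier pairs"
proof -
  have diff: "Poly_Mapping.keys (u - v) \<subseteq> UNIV \<times> C"
    if "Poly_Mapping.keys u \<subseteq> UNIV \<times> C" "Poly_Mapping.keys v \<subseteq> UNIV \<times> C" for u v :: "'r \<times> 'c \<Rightarrow>\<^sub>0 int"
    using keys_diff[of u v] that by blast
  show ?thesis
  proof
    fix u assume "u \<in> tensor_relators \<rho> P C act"
    then show "u \<in> carrier pairs"
      unfolding tensor_relators_def pairs_module_simps Un_iff mem_Collect_eq
      by (elim disjE exE conjE; hypsubst; intro diff; simp add: C_add act_closed)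
  qed
qed

sublocale N: abelian_subgroup kernel pairs
proof (rule abelian_subgroupI3[OF additive_subgroupI])
  interpret abelian_group pairs by (rule abelian_group_pairs_module)
  show "subgroup kernel (add_monoid pairs)"
    unfolding tensor_kernel_def
    by (rule group.generate_is_subgroup[OF a_group]) (use relators_subset in simp)
qed (rule abelian_group_pairs_module)

lemma kernel_subset: "kernel \<subseteq> carrier pairs"
  by (rule N.a_subset)

lemma kernel_zero: "0 \<in> kernel"
  using additive_subgroup.zero_closed[OF N.is_additive_subgroup] by simp

lemma kernel_add: "u \<in> kernel \<Longrightarrow> v \<in> kernel \<Longrightarrow> u + v \<in> kernel"
  using additive_subgroup.a_closed[OF N.is_additive_subgroup] by simp

lemma kernel_minus:
  assumes "u \<in> kernel"
  shows "- u \<in> kernel"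
proof -
  have "\<ominus>\<^bsub>pairs\<^esub> u = - u"
    by (rule a_inv_pairs_module) (use assms kernel_subset in blast)
  then show ?thesis
    using additive_subgroup.a_inv_closed[OF N.is_additive_subgroup assms] by (simp only:)
qed

lemma kernel_diff: "u \<in> kernel \<Longrightarrow> v \<in> kernel \<Longrightarrow> u - v \<in> kernel"
  using kernel_add[OF _ kernel_minus] by fastforce

lemma kernel_relator: "u \<in> tensor_relators \<rho> P C act \<Longrightarrow> u \<in> kernel"
  unfolding tensor_kernel_def by (rule generate.incl)

lemma kernel_add_left: "c \<in> C \<Longrightarrow> frag_of (r + s, c) - frag_of (r, c) - frag_of (s, c) \<in> kernel"
  by (rule kernel_relator) (auto simp: tensor_relators_def)

lemma kernel_add_right:
  "c \<in> C \<Longrightarrow> d \<in> C \<Longrightarrow> frag_of (r, c + d) - frag_of (r, c) - frag_of (r, d) \<in> kernel"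
  by (rule kernel_relator) (auto simp: tensor_relators_def)

lemma kernel_balanced: "a \<in> P \<Longrightarrow> c \<in> C \<Longrightarrow> frag_of (r * \<rho> a, c) - frag_of (r, act a c) \<in> kernel"
  by (rule kernel_relator) (auto simp: tensor_relators_def)

text \<open>Induction on the generated subgroup in additive form. A single case for differences
  replaces sums and inverses: -v is 0 - v, and u + v is u - (-v).\<close>

lemma kernel_induct [consumes 1, case_names zero add_left add_right balanced diff]:
  assumes "u \<in> kernel"
    and zero: "Q 0"
    and left: "\<And>r s c. c \<in> C \<Longrightarrow> Q (frag_of (r + s, c) - frag_of (r, c) - frag_of (s, c))"
    and right: "\<And>r c d. c \<in> C \<Longrightarrow> d \<in> C \<Longrightarrow> Q (frag_of (r, c + d) - frag_of (r, c) - frag_of (r, d))"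
    and bal: "\<And>r a c. a \<in> P \<Longrightarrow> c \<in> C \<Longrightarrow> Q (frag_of (r * \<rho> a, c) - frag_of (r, act a c))"
    and diff: "\<And>u v. Q u \<Longrightarrow> Q v \<Longrightarrow> Q (u - v)"
  shows "Q u"
proof -
  have rel: "Q v" if "v \<in> tensor_relators \<rho> P C act" for v
    using that left right bal by (auto simp: tensor_relators_def)
  have minus: "Q (- v)" if "Q v" for v
    using diff[OF zero that] by simp
  have inv_eq: "inv\<^bsub>add_monoid pairs\<^esub> v = - v" if "v \<in> tensor_relators \<rho> P C act" for v
    using a_inv_pairs_module[of v C] relators_subset that by (auto simp: a_inv_def)
  from assms(1) show ?thesis
    unfolding tensor_kernel_def
  proof (induction rule: generate.induct)
    case one
    then show ?case by (simp add: zero)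
  next
    case (incl h)
    then show ?case by (rule rel)
  next
    case (inv h)
    then show ?case by (simp only: inv_eq minus rel)
  next
    case (eng g h)
    then show ?case
      using diff[OF eng.IH(1) minus[OF eng.IH(2)]] by simp
  qed
qed

lemma coset_eq_kernel: "u \<in> carrier pairs \<Longrightarrow> kernel +>\<^bsub>pairs\<^esub> u = kernel \<longleftrightarrow> u \<in> kernel"
  using N.a_rcos_const N.a_rcos_self by blast

lemma coset_eqI:
  assumes "u \<in> carrier pairs" "v \<in> carrier pairs" "u - v \<in> kernel"
  shows "kernel +>\<^bsub>pairs\<^esub> u = kernel +>\<^bsub>pairs\<^esub> v"
proof -
  have "u \<in> kernel +>\<^bsub>pairs\<^esub> v"
    using assms(3) by (auto simp: a_r_coset_def' intro!: bexI[of _ "u - v"])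
  then show ?thesis
    using N.a_repr_independence'[OF _ assms(2)] by simp
qed

text \<open>Left additivity at 0 + 0 is the relator -(0, c).\<close>

lemma frag_of_zero_left: "c \<in> C \<Longrightarrow> frag_of (0, c) \<in> kernel"
  using kernel_minus[OF kernel_add_left[of c 0 0]] by simp

lemma frag_extend_closed:
  assumes "\<And>r c. c \<in> C \<Longrightarrow> b (r, c) \<in> carrier (pairs_module D)" "u \<in> carrier pairs"
  shows "frag_extend b u \<in> carrier (pairs_module D)"
  using keys_frag_extend[of b u] assms by fastforce

lemma scale_closed: "u \<in> carrier pairs \<Longrightarrow> r \<odot>\<^bsub>pairs\<^esub> u \<in> carrier pairs"
  using frag_extend_closed[of "\<lambda>(s, c). frag_of (r * s, c)" C u] by simp

text \<open>Scaling the first factor turns each relator into a relator of the same kind.\<close>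

lemma scale_kernel: "u \<in> kernel \<Longrightarrow> r \<odot>\<^bsub>pairs\<^esub> u \<in> kernel"
proof (induction rule: kernel_induct)
  case (add_left s t c)
  then show ?case
    using kernel_add_left[of c "r * s" "r * t"] by (simp add: frag_extend_diff distrib_left)
next
  case (add_right s c d)
  then show ?case
    using kernel_add_right by (simp add: frag_extend_diff)
next
  case (balanced s a c)
  then show ?case
    using kernel_balanced[of a c "r * s"] by (simp add: frag_extend_diff mult.assoc)
qed (simp_all add: kernel_zero frag_extend_diff kernel_diff)

lemma coset_in_tensor:
  "u \<in> carrier pairs \<Longrightarrow> kernel +>\<^bsub>pairs\<^esub> u \<in> carrier (tensor_module \<rho> P C act)"
  unfolding tensor_module_def quotient_module_simps by (rule imageI)

lemma smult_coset:
  assumes "u \<in> carrier pairs"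
  shows "r \<odot>\<^bsub>tensor_module \<rho> P C act\<^esub> (kernel +>\<^bsub>pairs\<^esub> u) = kernel +>\<^bsub>pairs\<^esub> (r \<odot>\<^bsub>pairs\<^esub> u)"
  unfolding tensor_module_def quotient_module_simps
proof (rule coset_map_coset)
  show "(\<odot>\<^bsub>pairs\<^esub>) r ` carrier pairs \<subseteq> carrier pairs"
    using scale_closed by blast
  show "(\<odot>\<^bsub>pairs\<^esub>) r ` kernel \<subseteq> kernel"
    using scale_kernel by blast
qed (simp_all add: N.is_abelian_subgroup assms[simplified] frag_extend_add)

text \<open>Associativity, the unit law and additivity in the tensor hold already for combinations
  of pairs. Additivity in the scalar holds only modulo the relators of left additivity, so it is the
  one law that is checked through membership in the kernel.\<close>

lemma module_tensor_module: "module type_ring (tensor_module \<rho> P C act)"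
proof (rule moduleI)
  show "cring (type_ring :: 'r ring)" by (rule cring_type_ring)
  show "abelian_group (tensor_module \<rho> P C act)"
  proof -
    have "abelian_group (quotient_module (pairs\<lparr>carrier := carrier pairs\<rparr>) kernel)"
      by (intro abelian_group_quotient_module abelian_group_pairs_module N.is_additive_subgroup
          additive_subgroup.intro N.a_group group.subgroup_self[of "add_monoid pairs", simplified partial_object.simps])
    moreover have "pairs\<lparr>carrier := carrier pairs\<rparr> = pairs"
      by (simp add: pairs_module_def)
    ultimately show ?thesis
      by (simp only: tensor_module_def)
  qed
  fix r s U V
  assume "U \<in> carrier (tensor_module \<rho> P C act)"
  then obtain u where u: "u \<in> carrier pairs" and U: "U = kernel +>\<^bsub>pairs\<^esub> u"
    unfolding tensor_module_def quotient_module_simps by fast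
  show "r \<odot>\<^bsub>tensor_module \<rho> P C act\<^esub> U \<in> carrier (tensor_module \<rho> P C act)"
    unfolding U smult_coset[OF u] by (rule coset_in_tensor[OF scale_closed[OF u]])
  have "(r + s) \<odot>\<^bsub>pairs\<^esub> u - (r \<odot>\<^bsub>pairs\<^esub> u + s \<odot>\<^bsub>pairs\<^esub> u) \<in> kernel"
    using u[simplified]
  proof (induction rule: frag_induction)
    case (one p)
    then show ?case
      using kernel_add_left[of "snd p" "r * fst p" "s * fst p"]
      by (auto simp: algebra_simps split: prod.splits)
  next
    case (diff u v)
    then show ?case
      using kernel_diff[OF diff] by (simp add: frag_extend_diff algebra_simps)
  qed (simp add: kernel_zero)
  then have "kernel +>\<^bsub>pairs\<^esub> ((r + s) \<odot>\<^bsub>pairs\<^esub> u) = kernel +>\<^bsub>pairs\<^esub> (r \<odot>\<^bsub>pairs\<^esub> u \<oplus>\<^bsub>pairs\<^esub> s \<odot>\<^bsub>pairs\<^esub> u)"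
    using scale_closed[OF u] N.a_closed by (intro coset_eqI) (simp_all del: pairs_module_simps(4) add: N.add.m_closed[simplified])
  also have "\<dots> = (kernel +>\<^bsub>pairs\<^esub> (r \<odot>\<^bsub>pairs\<^esub> u)) <+>\<^bsub>pairs\<^esub> (kernel +>\<^bsub>pairs\<^esub> (s \<odot>\<^bsub>pairs\<^esub> u))"
    by (rule N.a_rcos_sum[symmetric]) (rule scale_closed[OF u])+
  finally show "(r \<oplus>\<^bsub>type_ring\<^esub> s) \<odot>\<^bsub>tensor_module \<rho> P C act\<^esub> U
      = r \<odot>\<^bsub>tensor_module \<rho> P C act\<^esub> U \<oplus>\<^bsub>tensor_module \<rho> P C act\<^esub> s \<odot>\<^bsub>tensor_module \<rho> P C act\<^esub> U"
    by (simp only: U smult_coset[OF u] type_ring_simps) (simp add: tensor_module_def)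
  have "(r * s) \<odot>\<^bsub>pairs\<^esub> u = r \<odot>\<^bsub>pairs\<^esub> (s \<odot>\<^bsub>pairs\<^esub> u)"
    using u[simplified]
    by (induction rule: frag_induction) (auto simp: frag_extend_diff mult.assoc)
  then show "(r \<otimes>\<^bsub>type_ring\<^esub> s) \<odot>\<^bsub>tensor_module \<rho> P C act\<^esub> U
      = r \<odot>\<^bsub>tensor_module \<rho> P C act\<^esub> (s \<odot>\<^bsub>tensor_module \<rho> P C act\<^esub> U)"
    by (simp only: U smult_coset[OF u] smult_coset[OF scale_closed[OF u]] type_ring_simps)
  have "1 \<odot>\<^bsub>pairs\<^esub> u = u"
    using u[simplified]
    by (induction rule: frag_induction) (auto simp: frag_extend_diff)
  then show "\<one>\<^bsub>type_ring\<^esub> \<odot>\<^bsub>tensor_module \<rho> P C act\<^esub> U = U"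
    by (simp only: U smult_coset[OF u] type_ring_simps)
  assume "V \<in> carrier (tensor_module \<rho> P C act)"
  then obtain v where v: "v \<in> carrier pairs" and V: "V = kernel +>\<^bsub>pairs\<^esub> v"
    unfolding tensor_module_def quotient_module_simps by fast
  have add: "U \<oplus>\<^bsub>tensor_module \<rho> P C act\<^esub> V = kernel +>\<^bsub>pairs\<^esub> (u \<oplus>\<^bsub>pairs\<^esub> v)"
    by (simp only: U V tensor_module_def quotient_module_simps N.a_rcos_sum[OF u v])
  have "r \<odot>\<^bsub>tensor_module \<rho> P C act\<^esub> (U \<oplus>\<^bsub>tensor_module \<rho> P C act\<^esub> V)
      = kernel +>\<^bsub>pairs\<^esub> (r \<odot>\<^bsub>pairs\<^esub> u \<oplus>\<^bsub>pairs\<^esub> r \<odot>\<^bsub>pairs\<^esub> v)"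
    unfolding add by (subst smult_coset) (use u v N.add.m_closed in \<open>simp_all add: frag_extend_add\<close>)
  also have "\<dots> = (kernel +>\<^bsub>pairs\<^esub> (r \<odot>\<^bsub>pairs\<^esub> u)) <+>\<^bsub>pairs\<^esub> (kernel +>\<^bsub>pairs\<^esub> (r \<odot>\<^bsub>pairs\<^esub> v))"
    by (rule N.a_rcos_sum[symmetric]) (rule scale_closed[OF u] scale_closed[OF v])+
  finally show "r \<odot>\<^bsub>tensor_module \<rho> P C act\<^esub> (U \<oplus>\<^bsub>tensor_module \<rho> P C act\<^esub> V)
      = r \<odot>\<^bsub>tensor_module \<rho> P C act\<^esub> U \<oplus>\<^bsub>tensor_module \<rho> P C act\<^esub> r \<odot>\<^bsub>tensor_module \<rho> P C act\<^esub> V"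
    by (simp only: U V smult_coset[OF u] smult_coset[OF v]) (simp add: tensor_module_def)
qed

end

lemma poly_mapping_sum_single: "c = (\<Sum>e\<in>Poly_Mapping.keys c. Poly_Mapping.single e (Poly_Mapping.lookup c e))"
  by (rule poly_mapping_eqI) (simp add: lookup_sum lookup_single when_def in_keys_iff)

lemma keys_sum_subset:
  assumes "\<And>i. i \<in> I \<Longrightarrow> Poly_Mapping.keys (f i) \<subseteq> A"
  shows "Poly_Mapping.keys (sum f I) \<subseteq> A"
  using assms by (induction I rule: infinite_finite_induct) (use keys_add in fastforce)+

section \<open>Free group actions: orbit representatives and coordinates\<close>

locale free_action = group G for G :: "'p monoid" (structure) +
  fixes S :: "'e set" and tr :: "'p \<Rightarrow> 'e \<Rightarrow> 'e"
  assumes tr_closed: "g \<in> carrier G \<Longrightarrow> e \<in> S \<Longrightarrow> tr g e \<in> S"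
    and tr_mult: "g \<in> carrier G \<Longrightarrow> h \<in> carrier G \<Longrightarrow> e \<in> S \<Longrightarrow> tr (g \<otimes> h) e = tr g (tr h e)"
    and tr_one: "e \<in> S \<Longrightarrow> tr \<one> e = e"
    and tr_free: "g \<in> carrier G \<Longrightarrow> e \<in> S \<Longrightarrow> tr g e = e \<Longrightarrow> g = \<one>"
begin

text \<open>The choice is made from the orbit as a set, so it is the same for all its elements; this
  is what \<open>rep_tr\<close> uses.\<close>

definition rep :: "'e \<Rightarrow> 'e" where
  "rep e = (SOME f. f \<in> (\<lambda>g. tr g e) ` carrier G)"

definition coord :: "'e \<Rightarrow> 'p" where
  "coord e = (SOME g. g \<in> carrier G \<and> tr g (rep e) = e)"

lemma rep_in_orbit:
  obtains g where "g \<in> carrier G" "rep e = tr g e"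
proof -
  have "rep e \<in> (\<lambda>g. tr g e) ` carrier G"
    unfolding rep_def by (rule someI[of _ "tr \<one> e"]) blast
  with that show ?thesis by blast
qed

lemma rep_closed: "e \<in> S \<Longrightarrow> rep e \<in> S"
  using rep_in_orbit[of e] tr_closed by metis

lemma rep_tr:
  assumes "h \<in> carrier G" "e \<in> S"
  shows "rep (tr h e) = rep e"
proof -
  have "(\<lambda>g. tr g (tr h e)) ` carrier G = (\<lambda>g. tr g e) ` carrier G"
  proof (intro equalityI image_subsetI)
    fix g assume g: "g \<in> carrier G"
    show "tr g (tr h e) \<in> (\<lambda>g. tr g e) ` carrier G"
      using g assms by (intro image_eqI[of _ _ "g \<otimes> h"]) (simp_all add: tr_mult)
    have "tr g e = tr (g \<otimes> inv h \<otimes> h) e"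
      using g assms by (simp add: m_assoc)
    also have "\<dots> = tr (g \<otimes> inv h) (tr h e)"
      using g assms by (intro tr_mult) auto
    finally show "tr g e \<in> (\<lambda>g. tr g (tr h e)) ` carrier G"
      using g assms by blast
  qed
  then show ?thesis
    unfolding rep_def by simp
qed

lemma rep_rep: "e \<in> S \<Longrightarrow> rep (rep e) = rep e"
  using rep_in_orbit[of e] rep_tr by metis

lemma coord: "e \<in> S \<Longrightarrow> coord e \<in> carrier G \<and> tr (coord e) (rep e) = e"
  unfolding coord_def
proof (rule someI_ex)
  assume "e \<in> S"
  obtain g where g: "g \<in> carrier G" "rep e = tr g e"
    by (rule rep_in_orbit)
  then have "tr (inv g) (rep e) = e"
    using \<open>e \<in> S\<close> tr_mult[of "inv g" g e] by (simp add: tr_one)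
  then show "\<exists>g. g \<in> carrier G \<and> tr g (rep e) = e"
    using g by (intro exI[of _ "inv g"]) simp
qed

text \<open>Two group elements carrying \<open>rep e\<close> to \<open>e\<close> differ by an
  element that fixes \<open>rep e\<close>, and freeness makes it the identity.\<close>

lemma coord_unique:
  assumes "e \<in> S" "g \<in> carrier G" "tr g (rep e) = e"
  shows "g = coord e"
proof -
  have c: "coord e \<in> carrier G" "tr (coord e) (rep e) = e"
    using coord[OF assms(1)] by auto
  have "tr (inv (coord e) \<otimes> g) (rep e) = rep e"
    using assms c tr_mult[of "inv (coord e)" g "rep e"] tr_mult[of "inv (coord e)" "coord e" "rep e"]
    by (simp add: rep_closed tr_one)
  then have "inv (coord e) \<otimes> g = \<one>"
    using assms c by (intro tr_free[of _ "rep e"]) (simp_all add: rep_closed)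
  then show ?thesis
    using assms c by (metis inv_equality inv_inv inv_closed)
qed

text \<open>This equivariance is what makes the coordinates of a tensor respect the balancing
  relators.\<close>

lemma coord_tr:
  assumes "h \<in> carrier G" "e \<in> S"
  shows "coord (tr h e) = h \<otimes> coord e"
  using assms coord[OF assms(2)]
  by (intro coord_unique[symmetric]) (simp_all add: tr_closed tr_mult rep_tr rep_closed)

lemma coord_rep: "e \<in> S \<Longrightarrow> coord (rep e) = \<one>"
  by (rule coord_unique[symmetric]) (simp_all add: rep_closed rep_rep tr_one)

definition chains :: "('e \<Rightarrow>\<^sub>0 'k::comm_ring_1) set" where
  "chains = {c. Poly_Mapping.keys c \<subseteq> S}"

text \<open>The formula of \<open>group_ring_action\<close> for an abstract action, so that the two
  agree by unfolding.\<close>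

definition perm_action :: "('p \<Rightarrow>\<^sub>0 'k::comm_ring_1) \<Rightarrow> ('e \<Rightarrow>\<^sub>0 'k) \<Rightarrow> ('e \<Rightarrow>\<^sub>0 'k)" where
  "perm_action a c = (\<Sum>g\<in>Poly_Mapping.keys a. \<Sum>e\<in>Poly_Mapping.keys c.
     Poly_Mapping.single (tr g e) (Poly_Mapping.lookup a g * Poly_Mapping.lookup c e))"

lemma perm_action_closed:
  assumes "a \<in> group_ring_carrier G" "c \<in> chains"
  shows "perm_action a c \<in> chains"
  using assms unfolding perm_action_def chains_def group_ring_carrier_def mem_Collect_eq
  by (intro keys_sum_subset) (auto simp: tr_closed subset_iff)

end

section \<open>Coordinates on the tensor product of R with a free permutation module\<close>

text \<open>The weight \<open>w\<close> gives the image of a group element in R. Its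
  multiplicativity and that of \<open>\<epsilon>\<close> make \<open>\<rho>\<close> compatible with
  products in the group ring.\<close>

locale free_permutation_module = free_action G S tr
  for G :: "'p monoid" (structure) and S :: "'e set" and tr :: "'p \<Rightarrow> 'e \<Rightarrow> 'e" +
  fixes \<rho> :: "('p \<Rightarrow>\<^sub>0 'k::comm_ring_1) \<Rightarrow> 'r::comm_ring_1" and \<epsilon> :: "'k \<Rightarrow> 'r" and w :: "'p \<Rightarrow> 'r"
  assumes \<epsilon>_add: "\<epsilon> (\<alpha> + \<beta>) = \<epsilon> \<alpha> + \<epsilon> \<beta>" and \<epsilon>_mult: "\<epsilon> (\<alpha> * \<beta>) = \<epsilon> \<alpha> * \<epsilon> \<beta>"
    and \<epsilon>_one: "\<epsilon> 1 = 1"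
    and w_mult: "g \<in> carrier G \<Longrightarrow> h \<in> carrier G \<Longrightarrow> w (g \<otimes> h) = w g * w h"
    and w_one: "w \<one> = 1"
    and \<rho>: "\<rho> a = (\<Sum>g\<in>Poly_Mapping.keys a. \<epsilon> (Poly_Mapping.lookup a g) * w g)"
begin

lemma \<epsilon>_zero: "\<epsilon> 0 = 0"
  using \<epsilon>_add[of 0 0] by simp

sublocale tensor_product \<rho> "group_ring_carrier G" chains perm_action
proof
  show "c + d \<in> chains" if "c \<in> chains" "d \<in> chains" for c d :: "'e \<Rightarrow>\<^sub>0 'k"
    using that keys_add[of c d] unfolding chains_def by blast
qed (rule perm_action_closed)

text \<open>The coordinate of the tensor of r and c at the representative f. Since e is
  \<open>coord e\<close> applied to \<open>rep e\<close>, the group element is moved across the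
  tensor sign and becomes the factor \<open>w (coord e)\<close>.\<close>

definition \<phi> :: "'r \<Rightarrow> ('e \<Rightarrow>\<^sub>0 'k) \<Rightarrow> 'e \<Rightarrow> 'r" where
  "\<phi> r c f = (\<Sum>e\<in>Poly_Mapping.keys c. if rep e = f then r * \<epsilon> (Poly_Mapping.lookup c e) * w (coord e) else 0)"

lemma \<phi>_single: "\<phi> r (Poly_Mapping.single e a) f = (if rep e = f then r * \<epsilon> a * w (coord e) else 0)"
  by (simp add: \<phi>_def \<epsilon>_zero)

lemma \<phi>_add_left: "\<phi> (r + s) c f = \<phi> r c f + \<phi> s c f"
  unfolding \<phi>_def sum.distrib[symmetric] by (rule sum.cong) (simp_all add: distrib_right)

lemma \<phi>_mult: "\<phi> (r * s) c f = r * \<phi> s c f"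
  unfolding \<phi>_def sum_distrib_left by (rule sum.cong) (simp_all add: mult.assoc)

text \<open>Cancellation may remove keys from c + d. The summand is additive in the coefficient and
  0 at coefficient 0, so the sum may be taken over the keys of both chains.\<close>

lemma \<phi>_add_right: "\<phi> r (c + d) f = \<phi> r c f + \<phi> r d f"
  unfolding \<phi>_def
  by (rule setsum_keys_plus_distrib[where f = "\<lambda>e \<alpha>. if rep e = f then r * \<epsilon> \<alpha> * w (coord e) else 0"])
    (simp_all add: \<epsilon>_zero \<epsilon>_add algebra_simps)

lemma \<phi>_sum: "\<phi> r (sum h I) f = (\<Sum>i\<in>I. \<phi> r (h i) f)"
  by (induction I rule: infinite_finite_induct) (simp_all add: \<phi>_add_right, simp_all add: \<phi>_def)

text \<open>Translating e by g keeps the representative and multiplies the coordinate by g, hence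
  the weight by w g; weighted with the coefficients of a, these factors add up to \<rho> a.\<close>

lemma \<phi>_action:
  assumes "a \<in> group_ring_carrier G" "c \<in> chains"
  shows "\<phi> r (perm_action a c) f = \<phi> (r * \<rho> a) c f"
proof -
  have "\<phi> r (perm_action a c) f = (\<Sum>g\<in>Poly_Mapping.keys a. \<Sum>e\<in>Poly_Mapping.keys c.
      \<phi> r (Poly_Mapping.single (tr g e) (Poly_Mapping.lookup a g * Poly_Mapping.lookup c e)) f)"
    by (simp only: perm_action_def \<phi>_sum)
  also have "\<dots> = (\<Sum>g\<in>Poly_Mapping.keys a. \<Sum>e\<in>Poly_Mapping.keys c.
      if rep e = f then r * (\<epsilon> (Poly_Mapping.lookup a g) * w g) * \<epsilon> (Poly_Mapping.lookup c e) * w (coord e) else 0)"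
  proof (intro sum.cong refl)
    fix g e assume "g \<in> Poly_Mapping.keys a" "e \<in> Poly_Mapping.keys c"
    then have "g \<in> carrier G" "e \<in> S"
      using assms by (auto simp: group_ring_carrier_def chains_def)
    then show "\<phi> r (Poly_Mapping.single (tr g e) (Poly_Mapping.lookup a g * Poly_Mapping.lookup c e)) f
      = (if rep e = f then r * (\<epsilon> (Poly_Mapping.lookup a g) * w g) * \<epsilon> (Poly_Mapping.lookup c e) * w (coord e) else 0)"
      using coord[of e] by (simp add: \<phi>_single rep_tr coord_tr \<epsilon>_mult w_mult mult_ac)
  qed
  also have "\<dots> = (\<Sum>e\<in>Poly_Mapping.keys c. \<Sum>g\<in>Poly_Mapping.keys a.
      if rep e = f then r * (\<epsilon> (Poly_Mapping.lookup a g) * w g) * \<epsilon> (Poly_Mapping.lookup c e) * w (coord e) else 0)"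
    by (rule sum.swap)
  also have "\<dots> = \<phi> (r * \<rho> a) c f"
    unfolding \<phi>_def \<rho> by (intro sum.cong refl) (simp add: sum_distrib_left sum_distrib_right)
  finally show ?thesis .
qed

definition \<Phi> :: "('r \<times> ('e \<Rightarrow>\<^sub>0 'k) \<Rightarrow>\<^sub>0 int) \<Rightarrow> 'e \<Rightarrow> 'r" where
  "\<Phi> u f = (\<Sum>p\<in>Poly_Mapping.keys u. of_int (Poly_Mapping.lookup u p) * \<phi> (fst p) (snd p) f)"

lemma \<Phi>_of: "\<Phi> (frag_of (r, c)) f = \<phi> r c f"
  by (simp add: \<Phi>_def)

lemma \<Phi>_zero: "\<Phi> 0 f = 0"
  by (simp add: \<Phi>_def)

lemma \<Phi>_add: "\<Phi> (u + v) f = \<Phi> u f + \<Phi> v f"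
  unfolding \<Phi>_def
  by (rule setsum_keys_plus_distrib[where f = "\<lambda>p n. of_int n * \<phi> (fst p) (snd p) f"]) (simp_all add: algebra_simps)

lemma \<Phi>_diff: "\<Phi> (u - v) f = \<Phi> u f - \<Phi> v f"
  using \<Phi>_add[of "u - v" v f] by simp

lemma \<Phi>_kernel: "u \<in> kernel \<Longrightarrow> \<Phi> u f = 0"
proof (induction rule: kernel_induct)
  case (balanced r a c)
  then show ?case
    by (simp add: \<Phi>_diff \<Phi>_of \<phi>_action)
qed (simp_all add: \<Phi>_zero \<Phi>_diff \<Phi>_of \<phi>_add_left \<phi>_add_right)

lemma \<Phi>_scale:
  assumes "u \<in> carrier pairs"
  shows "\<Phi> (r \<odot>\<^bsub>pairs\<^esub> u) f = r * \<Phi> u f"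
  using assms[simplified]
proof (induction rule: frag_induction)
  case (one p)
  then show ?case by (cases p) (simp add: \<Phi>_of \<phi>_mult)
next
  case (diff u v)
  then show ?case by (simp add: frag_extend_diff \<Phi>_diff right_diff_distrib)
qed (simp add: \<Phi>_zero)

lemma frag_of_diff_left: "c \<in> chains \<Longrightarrow> frag_of (r - s, c) - (frag_of (r, c) - frag_of (s, c)) \<in> kernel"
  using kernel_minus[OF kernel_add_left[of c "r - s" s]] by (simp add: algebra_simps)

text \<open>\<open>\<Phi>\<close> induces the coordinate map on \<open>R \<otimes> k[S]\<close> for the basis \<open>1 \<otimes> rep e\<close>. A tensor \<open>expands\<close> if it is
  recovered from its coordinates modulo the kernel; that all tensors do makes \<open>\<Phi>\<close> injective.\<close>

definition expansion :: "'e set \<Rightarrow> ('e \<Rightarrow> 'r) \<Rightarrow> ('r \<times> ('e \<Rightarrow>\<^sub>0 'k) \<Rightarrow>\<^sub>0 int)" where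
  "expansion F h = (\<Sum>f\<in>F. frag_of (h f, Poly_Mapping.single f 1))"

definition expands :: "('r \<times> ('e \<Rightarrow>\<^sub>0 'k) \<Rightarrow>\<^sub>0 int) \<Rightarrow> bool" where
  "expands u \<longleftrightarrow> (\<exists>F0\<subseteq>S. finite F0 \<and> (\<forall>F. F0 \<subseteq> F \<longrightarrow> F \<subseteq> S \<longrightarrow> finite F \<longrightarrow> u - expansion F (\<Phi> u) \<in> kernel))"

lemma single_in_chains: "e \<in> S \<Longrightarrow> Poly_Mapping.single e a \<in> chains"
  by (simp add: chains_def)

lemma kernel_sum: "(\<And>i. i \<in> I \<Longrightarrow> f i \<in> kernel) \<Longrightarrow> sum f I \<in> kernel"
  by (induction I rule: infinite_finite_induct) (simp_all add: kernel_zero kernel_add)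

lemma expansion_zero: "F \<subseteq> S \<Longrightarrow> expansion F (\<lambda>_. 0) \<in> kernel"
  unfolding expansion_def by (intro kernel_sum frag_of_zero_left single_in_chains) blast

lemma expansion_diff:
  "F \<subseteq> S \<Longrightarrow> expansion F (\<lambda>f. h f - k f) - (expansion F h - expansion F k) \<in> kernel"
  unfolding expansion_def sum_subtractf[symmetric]
  by (intro kernel_sum frag_of_diff_left single_in_chains) blast

lemma expands_kernel:
  assumes "u \<in> kernel"
  shows "expands u"
proof -
  have "\<Phi> u = (\<lambda>_. 0)"
    using \<Phi>_kernel[OF assms] by blast
  then have "\<forall>F. {} \<subseteq> F \<longrightarrow> F \<subseteq> S \<longrightarrow> finite F \<longrightarrow> u - expansion F (\<Phi> u) \<in> kernel"
    using kernel_diff[OF assms expansion_zero] by simp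
  then show ?thesis
    unfolding expands_def by (intro exI[of _ "{}"]) simp
qed

text \<open>Each hypothesis holds for all finite sets beyond a threshold, so both can be used at one
  common \<open>F\<close>. This is why \<open>expands\<close> quantifies over all large
  \<open>F\<close> instead of fixing a support.\<close>

lemma expands_diff:
  assumes "expands u" "expands v"
  shows "expands (u - v)"
proof -
  obtain F1 where F1: "F1 \<subseteq> S" "finite F1"
    "\<And>F. F1 \<subseteq> F \<Longrightarrow> F \<subseteq> S \<Longrightarrow> finite F \<Longrightarrow> u - expansion F (\<Phi> u) \<in> kernel"
    using assms(1) unfolding expands_def by blast
  obtain F2 where F2: "F2 \<subseteq> S" "finite F2"
    "\<And>F. F2 \<subseteq> F \<Longrightarrow> F \<subseteq> S \<Longrightarrow> finite F \<Longrightarrow> v - expansion F (\<Phi> v) \<in> kernel"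
    using assms(2) unfolding expands_def by blast
  have "u - v - expansion F (\<Phi> (u - v)) \<in> kernel"
    if F: "F1 \<union> F2 \<subseteq> F" "F \<subseteq> S" "finite F" for F
  proof -
    have "\<Phi> (u - v) = (\<lambda>f. \<Phi> u f - \<Phi> v f)"
      using \<Phi>_diff by blast
    then have "u - v - expansion F (\<Phi> (u - v))
        = (u - expansion F (\<Phi> u)) - (v - expansion F (\<Phi> v))
          - (expansion F (\<lambda>f. \<Phi> u f - \<Phi> v f) - (expansion F (\<Phi> u) - expansion F (\<Phi> v)))"
      by simp
    also have "\<dots> \<in> kernel"
      using F by (intro kernel_diff F1(3) F2(3) expansion_diff) auto
    finally show ?thesis .
  qed
  then show ?thesis
    unfolding expands_def using F1(1,2) F2(1,2) by (intro exI[of _ "F1 \<union> F2"]) simp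
qed

text \<open>\<open>u\<close> equals \<open>(u - v) - (0 - v)\<close>, a difference of elements that
  expand.\<close>

lemma expands_cong: "expands v \<Longrightarrow> u - v \<in> kernel \<Longrightarrow> expands u"
  using expands_diff[OF expands_kernel[of "u - v"] expands_diff[OF expands_kernel[OF kernel_zero], of v]]
  by simp

text \<open>The only nonzero coordinate can be the one at \<open>rep e\<close>, where it is r. The
  other terms of the expansion are pairs with first entry 0, which are nonzero as formal pairs but
  lie in the kernel.\<close>

lemma expands_rep:
  assumes "e \<in> S"
  shows "expands (frag_of (r, Poly_Mapping.single (rep e) 1))"
proof -
  let ?u = "frag_of (r, Poly_Mapping.single (rep e) (1::'k))"
  have "?u - expansion F (\<Phi> ?u) \<in> kernel" if F: "{rep e} \<subseteq> F" "F \<subseteq> S" "finite F" for F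
  proof -
    have "expansion F (\<Phi> ?u) = frag_of (\<Phi> ?u (rep e), Poly_Mapping.single (rep e) 1)
        + (\<Sum>f\<in>F - {rep e}. frag_of (\<Phi> ?u f, Poly_Mapping.single f 1))"
      unfolding expansion_def using F by (intro sum.remove) auto
    also have "\<Phi> ?u (rep e) = r"
      using assms by (simp add: \<Phi>_of \<phi>_single rep_rep coord_rep w_one \<epsilon>_one)
    also have "(\<Sum>f\<in>F - {rep e}. frag_of (\<Phi> ?u f, Poly_Mapping.single f (1::'k)))
        = expansion (F - {rep e}) (\<lambda>_. 0)"
      unfolding expansion_def using assms
      by (intro sum.cong refl) (auto simp: \<Phi>_of \<phi>_single rep_rep)
    finally have "?u - expansion F (\<Phi> ?u) = - expansion (F - {rep e}) (\<lambda>_. 0)"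
      by simp
    also have "\<dots> \<in> kernel"
      using F by (intro kernel_minus expansion_zero) blast
    finally show ?thesis .
  qed
  then show ?thesis
    unfolding expands_def using rep_closed[OF assms] by (intro exI[of _ "{rep e}"]) simp
qed

text \<open>Balancing with a times \<open>coord e\<close> replaces the cell e by its representative,
  at the cost of a factor in R.\<close>

lemma expands_single:
  assumes "e \<in> S"
  shows "expands (frag_of (r, Poly_Mapping.single e a))"
proof -
  let ?a = "Poly_Mapping.single (coord e) a"
  have c: "coord e \<in> carrier G" "tr (coord e) (rep e) = e"
    using coord[OF assms] by auto
  then have "?a \<in> group_ring_carrier G"
    by (simp add: group_ring_carrier_def)
  then have "frag_of (r * \<rho> ?a, Poly_Mapping.single (rep e) 1)
      - frag_of (r, perm_action ?a (Poly_Mapping.single (rep e) 1)) \<in> kernel"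
    by (intro kernel_balanced single_in_chains rep_closed assms)
  moreover have "perm_action ?a (Poly_Mapping.single (rep e) 1) = Poly_Mapping.single e a"
    by (cases "a = 0") (simp_all add: perm_action_def c)
  ultimately have "frag_of (r, Poly_Mapping.single e a) - frag_of (r * \<rho> ?a, Poly_Mapping.single (rep e) 1) \<in> kernel"
    using kernel_minus by fastforce
  with expands_rep[OF assms] show ?thesis
    by (rule expands_cong)
qed

lemma expands_frag_of_sum:
  assumes "finite I" "I \<subseteq> S"
  shows "expands (frag_of (r, \<Sum>e\<in>I. Poly_Mapping.single e (h e)))"
  using assms
proof induction
  case empty
  have "frag_of (r, 0) \<in> kernel"
    using kernel_minus[OF kernel_add_right[of 0 0 r]] by (simp add: chains_def)
  then show ?case by (simp add: expands_kernel)
next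
  case (insert e I)
  let ?c = "\<Sum>e\<in>I. Poly_Mapping.single e (h e)"
  let ?s = "Poly_Mapping.single e (h e)"
  have I: "e \<in> S" "I \<subseteq> S"
    using insert.prems by auto
  then have "?c \<in> chains"
    unfolding chains_def mem_Collect_eq by (intro keys_sum_subset) (auto split: if_splits)
  moreover have "?s \<in> chains"
    using I by (intro single_in_chains)
  \<comment> \<open>Sums are written as differences from 0, in the form that
    \<open>expands_diff\<close> accepts.\<close>
  ultimately have "frag_of (r, ?s + ?c) - (frag_of (r, ?s) - (0 - frag_of (r, ?c))) \<in> kernel"
    using kernel_add_right[of ?s ?c r] by (simp add: algebra_simps)
  moreover have "expands (frag_of (r, ?s) - (0 - frag_of (r, ?c)))"
    using I by (intro expands_diff expands_single expands_kernel[OF kernel_zero] insert.IH)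
  ultimately show ?case
    using insert.hyps expands_cong by simp
qed

lemma expands_all: "u \<in> carrier pairs \<Longrightarrow> expands u"
  unfolding pairs_module_simps mem_Collect_eq
proof (induction rule: frag_induction)
  case (one p)
  then show ?case
    using expands_frag_of_sum[of "Poly_Mapping.keys (snd p)" "fst p" "Poly_Mapping.lookup (snd p)"]
    by (cases p) (simp add: chains_def flip: poly_mapping_sum_single)
qed (simp_all add: expands_kernel kernel_zero expands_diff)

text \<open>If all coordinates vanish, the expansion is a sum of pairs with first entry 0. It lies
  in the kernel, and so does everything congruent to it.\<close>

lemma kernel_iff:
  assumes "u \<in> carrier pairs"
  shows "u \<in> kernel \<longleftrightarrow> (\<forall>f. \<Phi> u f = 0)"
proof
  assume "\<forall>f. \<Phi> u f = 0"
  then have *: "\<Phi> u = (\<lambda>_. 0)" by (intro ext) simp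
  obtain F where F: "F \<subseteq> S" "u - expansion F (\<Phi> u) \<in> kernel"
    using expands_all[OF assms] unfolding expands_def by blast
  show "u \<in> kernel"
    using kernel_add[OF F(2)[unfolded *] expansion_zero[OF F(1)]] by simp
qed (simp add: \<Phi>_kernel)

text \<open>Vanishing of a tensor is a condition on its coordinates, and there \<open>x\<close> acts
  by multiplication in R.\<close>

lemma tensor_regular:
  assumes x: "\<And>r. x * r = 0 \<Longrightarrow> r = 0"
    and z: "z \<in> carrier (tensor_module \<rho> (group_ring_carrier G) chains perm_action)"
      "x \<odot>\<^bsub>tensor_module \<rho> (group_ring_carrier G) chains perm_action\<^esub> z
        = \<zero>\<^bsub>tensor_module \<rho> (group_ring_carrier G) chains perm_action\<^esub>"
  shows "z = \<zero>\<^bsub>tensor_module \<rho> (group_ring_carrier G) chains perm_action\<^esub>"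
proof -
  obtain u where u: "u \<in> carrier pairs" "z = kernel +>\<^bsub>pairs\<^esub> u"
    using z(1) unfolding tensor_module_def quotient_module_simps by blast
  have "kernel +>\<^bsub>pairs\<^esub> (x \<odot>\<^bsub>pairs\<^esub> u) = kernel"
    using z(2) unfolding u(2) smult_coset[OF u(1)] by (simp add: tensor_module_def)
  then have "x \<odot>\<^bsub>pairs\<^esub> u \<in> kernel"
    using coset_eq_kernel[OF scale_closed[OF u(1)]] by blast
  then have "\<Phi> u f = 0" for f
    using \<Phi>_kernel[of "x \<odot>\<^bsub>pairs\<^esub> u" f] \<Phi>_scale[OF u(1), of x f] x by simp
  then have "u \<in> kernel"
    using kernel_iff[OF u(1)] by blast
  then have "z = kernel"
    using coset_eq_kernel[OF u(1)] u(2) by blast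
  then show ?thesis
    by (simp add: tensor_module_def)
qed

end

section \<open>Fundamental group and universal cover\<close>

text \<open>The homotopy takes place among linear paths in the interval [0, 1] and is pushed forward
  along \<open>p\<close>, a continuous map from the interval to \<open>S\<close>. In this way the
  law holds in any topological space, and the next two laws are obtained likewise.\<close>

lemma homotopic_paths_rid_const:
  fixes p :: "real \<Rightarrow> 'a::topological_space"
  assumes "path p" "path_image p \<subseteq> S" "pathfinish p = y"
  shows "homotopic_paths S (p +++ (\<lambda>_. y)) p"
proof -
  have "homotopic_paths {0..1} (linepath 0 1 +++ linepath 1 1) (linepath 0 (1::real))"
    using homotopic_paths_rid[of "linepath 0 (1::real)" "{0..1}"] by (simp add: closed_segment_eq_real_ivl)
  then have "homotopic_paths S (p \<circ> (linepath 0 1 +++ linepath 1 1)) (p \<circ> linepath 0 1)"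
    by (rule homotopic_paths_continuous_image) (use assms in \<open>auto simp: path_def path_image_def\<close>)
  moreover have "p \<circ> linepath 0 1 = p" "p \<circ> linepath 1 1 = (\<lambda>_. y)"
    using assms(3) by (auto simp: linepath_def pathfinish_def fun_eq_iff)
  ultimately show ?thesis
    by (simp add: path_compose_join)
qed

lemma homotopic_paths_lid_const:
  fixes p :: "real \<Rightarrow> 'a::topological_space"
  assumes "path p" "path_image p \<subseteq> S" "pathstart p = y"
  shows "homotopic_paths S ((\<lambda>_. y) +++ p) p"
proof -
  have "homotopic_paths {0..1} (linepath 0 0 +++ linepath 0 1) (linepath 0 (1::real))"
    using homotopic_paths_lid[of "linepath 0 (1::real)" "{0..1}"] by (simp add: closed_segment_eq_real_ivl)
  then have "homotopic_paths S (p \<circ> (linepath 0 0 +++ linepath 0 1)) (p \<circ> linepath 0 1)"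
    by (rule homotopic_paths_continuous_image) (use assms in \<open>auto simp: path_def path_image_def\<close>)
  moreover have "p \<circ> linepath 0 1 = p" "p \<circ> linepath 0 0 = (\<lambda>_. y)"
    using assms(3) by (auto simp: linepath_def pathstart_def fun_eq_iff)
  ultimately show ?thesis
    by (simp add: path_compose_join)
qed

lemma homotopic_paths_rinv_const:
  fixes p :: "real \<Rightarrow> 'a::topological_space"
  assumes "path p" "path_image p \<subseteq> S" "pathstart p = y"
  shows "homotopic_paths S (p +++ reversepath p) (\<lambda>_. y)"
proof -
  have "homotopic_paths {0..1} (linepath 0 1 +++ reversepath (linepath 0 1)) (linepath 0 (0::real))"
    using homotopic_paths_rinv[of "linepath 0 (1::real)" "{0..1}"] by (simp add: closed_segment_eq_real_ivl)
  then have "homotopic_paths S (p \<circ> (linepath 0 1 +++ reversepath (linepath 0 1))) (p \<circ> linepath 0 0)"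
    by (rule homotopic_paths_continuous_image) (use assms in \<open>auto simp: path_def path_image_def\<close>)
  moreover have "p \<circ> linepath 0 1 = p" "p \<circ> linepath 0 0 = (\<lambda>_. y)"
    using assms(3) by (auto simp: linepath_def pathstart_def fun_eq_iff)
  ultimately show ?thesis
    by (simp add: path_compose_join path_compose_reversepath del: reversepath_linepath)
qed

lemma homotopic_paths_linv_const:
  fixes p :: "real \<Rightarrow> 'a::topological_space"
  assumes "path p" "path_image p \<subseteq> S" "pathfinish p = y"
  shows "homotopic_paths S (reversepath p +++ p) (\<lambda>_. y)"
  using homotopic_paths_rinv_const[of "reversepath p" S y] assms by simp

lemma path_const: "path (\<lambda>_. y)"
  by (simp add: path_def)

lemma path_class_eqI: "homotopic_paths X f g \<Longrightarrow> path_class X f = path_class X g"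
  unfolding path_class_def by (blast intro: homotopic_paths_trans homotopic_paths_sym)

lemma path_class_eqD:
  assumes "path_class X f = path_class X g" "path g" "path_image g \<subseteq> X"
  shows "homotopic_paths X f g"
proof -
  have "g \<in> path_class X g"
    using assms(2,3) by (simp add: path_class_def)
  with assms(1) show ?thesis
    by (metis mem_Collect_eq path_class_def)
qed

lemma class_join_path_class:
  assumes "path f" "path_image f \<subseteq> X" "path g" "path_image g \<subseteq> X" "pathfinish f = pathstart g"
  shows "class_join X (path_class X f) (path_class X g) = path_class X (f +++ g)"
proof (intro equalityI subsetI)
  fix h assume "h \<in> class_join X (path_class X f) (path_class X g)"
  then obtain f' g' where *: "homotopic_paths X f f'" "homotopic_paths X g g'" "homotopic_paths X (f' +++ g') h"
    by (auto simp: class_join_def path_class_def)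
  then have "homotopic_paths X (f +++ g) (f' +++ g')"
    using assms(5) by (intro homotopic_paths_join)
  then show "h \<in> path_class X (f +++ g)"
    using *(3) by (auto simp: path_class_def intro: homotopic_paths_trans)
next
  fix h assume "h \<in> path_class X (f +++ g)"
  then show "h \<in> class_join X (path_class X f) (path_class X g)"
    using assms unfolding class_join_def path_class_def mem_Collect_eq
    by (intro bexI[of _ f] bexI[of _ g] conjI) (simp_all)
qed

section \<open>The fundamental group and its action on the points of the universal cover\<close>

definition loops :: "'a::topological_space set \<Rightarrow> 'a \<Rightarrow> (real \<Rightarrow> 'a) set" where
  "loops X b = {g. path g \<and> path_image g \<subseteq> X \<and> pathstart g = b \<and> pathfinish g = b}"

lemma loops_const: "b \<in> X \<Longrightarrow> (\<lambda>_. b) \<in> loops X b"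
  by (simp add: loops_def path_const path_image_def pathstart_def pathfinish_def image_subset_iff)

lemma loops_join: "f \<in> loops X b \<Longrightarrow> g \<in> loops X b \<Longrightarrow> f +++ g \<in> loops X b"
  by (simp add: loops_def subset_path_image_join)

lemma loops_reverse: "f \<in> loops X b \<Longrightarrow> reversepath f \<in> loops X b"
  by (simp add: loops_def)

lemma paths_from_join: "f \<in> loops X b \<Longrightarrow> p \<in> paths_from X b \<Longrightarrow> f +++ p \<in> paths_from X b"
  by (simp add: loops_def paths_from_def subset_path_image_join)

lemma loops_subset: "loops X b \<subseteq> paths_from X b"
  by (auto simp: loops_def paths_from_def)

lemma fundamental_group_simps:
  "carrier (fundamental_group X b) = path_class X ` loops X b"
  "monoid.mult (fundamental_group X b) = class_join X"
  "one (fundamental_group X b) = path_class X (\<lambda>_. b)"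
  by (simp_all add: fundamental_group_def loops_def)

text \<open>The point set of the universal cover, so that the algebra of the action can be done
  apart from the topology.\<close>

definition cover_points :: "'a::topological_space set \<Rightarrow> 'a \<Rightarrow> (real \<Rightarrow> 'a) set set" where
  "cover_points X b = path_class X ` paths_from X b"

lemma class_join_loop:
  "f \<in> loops X b \<Longrightarrow> p \<in> paths_from X b \<Longrightarrow>
    class_join X (path_class X f) (path_class X p) = path_class X (f +++ p)"
  by (rule class_join_path_class) (auto simp: loops_def paths_from_def)

lemma class_join_loops:
  "f \<in> loops X b \<Longrightarrow> g \<in> loops X b \<Longrightarrow>
    class_join X (path_class X f) (path_class X g) = path_class X (f +++ g)"
  using class_join_loop loops_subset by blast

lemma class_join_closed:
  "A \<in> carrier (fundamental_group X b) \<Longrightarrow> x \<in> cover_points X b \<Longrightarrow> class_join X A x \<in> cover_points X b"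
  unfolding fundamental_group_simps cover_points_def
  by (auto simp: class_join_loop[of _ X b] paths_from_join)

lemma class_join_assoc:
  assumes "A \<in> carrier (fundamental_group X b)" "B \<in> carrier (fundamental_group X b)" "x \<in> cover_points X b"
  shows "class_join X (class_join X A B) x = class_join X A (class_join X B x)"
proof -
  obtain f g p where *: "f \<in> loops X b" "g \<in> loops X b" "p \<in> paths_from X b"
    "A = path_class X f" "B = path_class X g" "x = path_class X p"
    using assms unfolding fundamental_group_simps cover_points_def by blast
  have "homotopic_paths X (f +++ (g +++ p)) ((f +++ g) +++ p)"
    using * by (intro homotopic_paths_assoc) (auto simp: loops_def paths_from_def)
  then have "path_class X (f +++ (g +++ p)) = path_class X ((f +++ g) +++ p)"
    by (rule path_class_eqI)
  then show ?thesis
    using * by (simp add: class_join_loops[of _ X b] class_join_loop[of _ X b] loops_join paths_from_join)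
qed

lemma class_join_one:
  assumes "b \<in> X" "x \<in> cover_points X b"
  shows "class_join X (path_class X (\<lambda>_. b)) x = x"
proof -
  obtain p where p: "p \<in> paths_from X b" "x = path_class X p"
    using assms unfolding cover_points_def by blast
  then have "homotopic_paths X ((\<lambda>_. b) +++ p) p"
    by (intro homotopic_paths_lid_const) (auto simp: paths_from_def)
  then show ?thesis
    using p assms by (simp add: class_join_loop[of _ X b] loops_const path_class_eqI)
qed

text \<open>If f p is homotopic to p, cancel p on the right: f is homotopic to f (p p^-1), hence to
  (f p) p^-1, to p p^-1 and to the constant path.\<close>

lemma class_join_free:
  assumes "A \<in> carrier (fundamental_group X b)" "x \<in> cover_points X b" "class_join X A x = x"
  shows "A = path_class X (\<lambda>_. b)"
proof -
  obtain f p where *: "f \<in> loops X b" "p \<in> paths_from X b" "A = path_class X f" "x = path_class X p"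
    using assms unfolding fundamental_group_simps cover_points_def by blast
  have f: "path f" "path_image f \<subseteq> X" "pathstart f = b" "pathfinish f = b"
    using *(1) by (auto simp: loops_def)
  have p: "path p" "path_image p \<subseteq> X" "pathstart p = b"
    using *(2) by (auto simp: paths_from_def)
  have "homotopic_paths X (f +++ p) p"
    using assms(3) * p by (intro path_class_eqD) (simp_all add: class_join_loop[of _ X b])
  then have 1: "homotopic_paths X ((f +++ p) +++ reversepath p) (p +++ reversepath p)"
    using p by (intro homotopic_paths_join) auto
  have 2: "homotopic_paths X (f +++ (p +++ reversepath p)) ((f +++ p) +++ reversepath p)"
    using f p by (intro homotopic_paths_assoc) auto
  have 3: "homotopic_paths X (p +++ reversepath p) (\<lambda>_. b)"
    using p by (intro homotopic_paths_rinv_const) auto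
  then have 4: "homotopic_paths X (f +++ (p +++ reversepath p)) (f +++ (\<lambda>_. b))"
    using f p by (intro homotopic_paths_join) auto
  have 5: "homotopic_paths X (f +++ (\<lambda>_. b)) f"
    using f by (intro homotopic_paths_rid_const) auto
  have "homotopic_paths X f (\<lambda>_. b)"
    using 1 2 3 4 5 by (meson homotopic_paths_sym homotopic_paths_trans)
  then show ?thesis
    using * by (simp add: path_class_eqI)
qed

text \<open>Loops are paths from \<open>b\<close>, so unit and associativity laws are instances of
  those for the action on \<open>cover_points\<close>; reversed loops give inverses.\<close>

lemma group_fundamental_group:
  assumes "b \<in> X"
  shows "group (fundamental_group X b)"
proof (rule groupI, unfold fundamental_group_simps)
  show "path_class X (\<lambda>_. b) \<in> path_class X ` loops X b"
    using loops_const[OF assms] by blast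
  fix A assume A: "A \<in> path_class X ` loops X b"
  have sub: "path_class X ` loops X b \<subseteq> cover_points X b"
    using loops_subset unfolding cover_points_def by blast
  show "class_join X (path_class X (\<lambda>_. b)) A = A"
    using class_join_one[OF assms] A sub by blast
  obtain f where f: "f \<in> loops X b" "A = path_class X f"
    using A by blast
  have "homotopic_paths X (reversepath f +++ f) (\<lambda>_. b)"
    using f by (intro homotopic_paths_linv_const) (auto simp: loops_def)
  then have "class_join X (path_class X (reversepath f)) A = path_class X (\<lambda>_. b)"
    using f by (simp add: class_join_loops[of _ X b] loops_reverse path_class_eqI)
  then show "\<exists>B\<in>path_class X ` loops X b. class_join X B A = path_class X (\<lambda>_. b)"
    using loops_reverse[OF f(1)] by blast
  fix B assume B: "B \<in> path_class X ` loops X b"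
  then obtain g where g: "g \<in> loops X b" "B = path_class X g"
    by blast
  show "class_join X A B \<in> path_class X ` loops X b"
    using f g by (simp add: class_join_loops[of _ X b] loops_join)
  fix D assume "D \<in> path_class X ` loops X b"
  then show "class_join X (class_join X A B) D = class_join X A (class_join X B D)"
    using A B sub by (intro class_join_assoc) (auto simp: fundamental_group_simps)
qed

section \<open>The topology of the universal cover and continuity of translations\<close>

definition cover_basis :: "'a::topological_space set \<Rightarrow> (real \<Rightarrow> 'a) \<Rightarrow> 'a set \<Rightarrow> (real \<Rightarrow> 'a) set set" where
  "cover_basis X g U = {path_class X (g +++ h) | h. path h \<and> path_image h \<subseteq> U \<and> pathstart h = pathfinish g}"

lemma universal_cover_eq:
  "universal_cover X b = topology_generated_by
     {cover_basis X g U | g U. g \<in> paths_from X b \<and> openin (top_of_set X) U}"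
  by (simp add: universal_cover_def cover_basis_def)

text \<open>Every class of a path g lies in the basic set of g and the whole space \<open>X\<close>,
  because g may be prolonged by the constant path at its end.\<close>

lemma topspace_universal_cover: "topspace (universal_cover X b) = cover_points X b"
proof (intro equalityI subsetI)
  fix x assume "x \<in> topspace (universal_cover X b)"
  then obtain g U where g: "g \<in> paths_from X b" "openin (top_of_set X) U" "x \<in> cover_basis X g U"
    unfolding universal_cover_eq topology_generated_by_topspace by blast
  then obtain h where h: "path h" "path_image h \<subseteq> U" "pathstart h = pathfinish g" "x = path_class X (g +++ h)"
    unfolding cover_basis_def by blast
  have "U \<subseteq> X"
    using g(2) openin_imp_subset by blast
  then have "g +++ h \<in> paths_from X b"
    using g(1) h by (auto simp: paths_from_def subset_path_image_join)
  then show "x \<in> cover_points X b"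
    using h(4) by (simp add: cover_points_def)
next
  fix x assume "x \<in> cover_points X b"
  then obtain g where g: "g \<in> paths_from X b" "x = path_class X g"
    by (auto simp: cover_points_def)
  let ?h = "\<lambda>_::real. pathfinish g"
  have "homotopic_paths X (g +++ ?h) g"
    using g by (intro homotopic_paths_rid_const) (auto simp: paths_from_def)
  then have "x = path_class X (g +++ ?h)"
    using g path_class_eqI by blast
  moreover have "path ?h" "path_image ?h \<subseteq> X" "pathstart ?h = pathfinish g"
    using g pathfinish_in_path_image[of g]
    by (auto simp: paths_from_def path_const path_image_def pathstart_def)
  ultimately have "x \<in> cover_basis X g X"
    unfolding cover_basis_def by (intro CollectI exI[of _ ?h] conjI)
  moreover have "cover_basis X g X \<in> {cover_basis X g U | g U. g \<in> paths_from X b \<and> openin (top_of_set X) U}"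
    using g(1) by (intro CollectI exI[of _ g] exI[of _ X]) simp
  ultimately show "x \<in> topspace (universal_cover X b)"
    unfolding universal_cover_eq topology_generated_by_topspace by (rule UnionI[rotated])
qed

text \<open>Translation by [a] pulls the basic set of g and U back to the basic set of a^-1 g and
  the same U: prepending a loop leaves the end of g unchanged.\<close>

lemma continuous_map_class_join:
  assumes "b \<in> X" "A \<in> carrier (fundamental_group X b)"
  shows "continuous_map (universal_cover X b) (universal_cover X b) (class_join X A)"
proof -
  obtain a where a: "a \<in> loops X b" "A = path_class X a"
    using assms(2) by (auto simp: fundamental_group_simps)
  let ?B = "path_class X (reversepath a)"
  have B: "?B \<in> carrier (fundamental_group X b)"
    using loops_reverse[OF a(1)] by (simp add: fundamental_group_simps)
  have AB: "class_join X ?B A = path_class X (\<lambda>_. b)" "class_join X A ?B = path_class X (\<lambda>_. b)"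
  proof -
    have "homotopic_paths X (reversepath a +++ a) (\<lambda>_. b)" "homotopic_paths X (a +++ reversepath a) (\<lambda>_. b)"
      using a(1) by (auto intro!: homotopic_paths_linv_const homotopic_paths_rinv_const simp: loops_def)
    then show "class_join X ?B A = path_class X (\<lambda>_. b)" "class_join X A ?B = path_class X (\<lambda>_. b)"
      using a loops_reverse[OF a(1)] by (simp_all add: class_join_loops[of _ X b] path_class_eqI)
  qed
  have translate: "path_class X ((f +++ g) +++ h) = class_join X (path_class X f) (path_class X (g +++ h))"
    if "f \<in> loops X b" "g \<in> paths_from X b" "path h" "path_image h \<subseteq> X" "pathstart h = pathfinish g" for f g h
  proof -
    have "homotopic_paths X (f +++ (g +++ h)) ((f +++ g) +++ h)"
      using that by (intro homotopic_paths_assoc) (auto simp: loops_def paths_from_def)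
    then have "path_class X (f +++ (g +++ h)) = path_class X ((f +++ g) +++ h)"
      by (rule path_class_eqI)
    moreover have "g +++ h \<in> paths_from X b"
      using that by (auto simp: paths_from_def subset_path_image_join)
    ultimately show ?thesis
      using that by (simp add: class_join_loop[of _ X b])
  qed
  have "class_join X A -` V \<inter> topspace (universal_cover X b) = cover_basis X (reversepath a +++ g) U"
    if V: "V = cover_basis X g U" and g: "g \<in> paths_from X b" and U: "openin (top_of_set X) U" for V g U
  proof (intro equalityI subsetI)
    have UX: "U \<subseteq> X" using U openin_imp_subset by blast
    {
      fix x assume "x \<in> class_join X A -` V \<inter> topspace (universal_cover X b)"
      then obtain h where h: "path h" "path_image h \<subseteq> U" "pathstart h = pathfinish g"
        "class_join X A x = path_class X (g +++ h)" and x: "x \<in> cover_points X b"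
        unfolding V cover_basis_def topspace_universal_cover by blast
      have "x = class_join X (class_join X ?B A) x"
        using AB x class_join_one[OF assms(1)] by simp
      also have "\<dots> = class_join X ?B (path_class X (g +++ h))"
        using class_join_assoc[OF B assms(2) x] h(4) by simp
      also have "\<dots> = path_class X ((reversepath a +++ g) +++ h)"
        using h UX by (intro translate[symmetric] loops_reverse a g) auto
      finally show "x \<in> cover_basis X (reversepath a +++ g) U"
        using h unfolding cover_basis_def by auto
    }
    fix x assume "x \<in> cover_basis X (reversepath a +++ g) U"
    then obtain h where h: "path h" "path_image h \<subseteq> U" "pathstart h = pathfinish g"
        "x = path_class X ((reversepath a +++ g) +++ h)"
      unfolding cover_basis_def by auto
    have gh: "path_class X (g +++ h) \<in> cover_points X b"
      using h UX g unfolding cover_points_def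
      by (intro imageI) (auto simp: paths_from_def subset_path_image_join)
    have x: "x = class_join X ?B (path_class X (g +++ h))"
      unfolding h(4) using h UX by (intro translate loops_reverse a g) auto
    then have "class_join X A x = path_class X (g +++ h)"
      using class_join_assoc[OF assms(2) B gh] AB class_join_one[OF assms(1) gh] by simp
    then show "x \<in> class_join X A -` V \<inter> topspace (universal_cover X b)"
      using h gh x class_join_closed[OF B gh] unfolding V cover_basis_def topspace_universal_cover by auto
  qed
  moreover have "reversepath a +++ g \<in> paths_from X b" if "g \<in> paths_from X b" for g
    using that by (intro paths_from_join loops_reverse a)
  ultimately have "openin (universal_cover X b) (class_join X A -` V \<inter> topspace (universal_cover X b))"
    if "V \<in> {cover_basis X g U | g U. g \<in> paths_from X b \<and> openin (top_of_set X) U}" for V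
    using that unfolding universal_cover_eq by (auto intro!: topology_generated_by_Basis) (metis)
  moreover have "class_join X A ` topspace (universal_cover X b)
      \<subseteq> \<Union> {cover_basis X g U | g U. g \<in> paths_from X b \<and> openin (top_of_set X) U}"
    using class_join_closed[OF assms(2)]
    unfolding topology_generated_by_topspace[symmetric] universal_cover_eq[symmetric] topspace_universal_cover
    by blast
  ultimately show ?thesis
    by (subst (2) universal_cover_eq) (rule continuous_on_generated_topo)
qed

lemma cover_proj_path_class:
  assumes "p \<in> paths_from X b"
  shows "cover_proj (path_class X p) = pathfinish p"
  unfolding cover_proj_def
proof (rule the_equality)
  show "\<exists>g\<in>path_class X p. pathfinish g = pathfinish p"
    using assms by (intro bexI[of _ p]) (auto simp: path_class_def paths_from_def)
qed (auto simp: path_class_def dest: homotopic_paths_imp_pathfinish)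

lemma cover_proj_class_join:
  assumes "A \<in> carrier (fundamental_group X b)" "x \<in> cover_points X b"
  shows "cover_proj (class_join X A x) = cover_proj x"
proof -
  obtain f p where *: "f \<in> loops X b" "p \<in> paths_from X b" "A = path_class X f" "x = path_class X p"
    using assms unfolding fundamental_group_simps cover_points_def by blast
  then show ?thesis
    by (simp add: class_join_loop[of _ X b] cover_proj_path_class[of _ X b] paths_from_join)
qed

section \<open>Translation of cells and invariance of incidence numbers\<close>

lemma topspace_disc_space: "topspace (disc_space n) = disc n"
  by (simp add: disc_space_def)

lemma open_disc_subset: "open_disc n \<subseteq> disc n"
  by (auto simp: open_disc_def disc_def)

lemma nsphere_subset_disc: "topspace (nsphere m) \<subseteq> disc (Suc m)"
  by (auto simp: nsphere disc_def lessThan_Suc_atMost)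

text \<open>The centre lies in every disc, also in dimension 0; freeness on cells is tested
  there.\<close>

lemma zero_in_disc: "(\<lambda>_. 0) \<in> disc n"
  by (simp add: disc_def)

lemma cover_cellsD:
  assumes "e \<in> cover_cells X b K n"
  shows "fst e \<in> cells K" "int (cdim K (fst e)) = n" "snd e \<in> extensional (disc (cdim K (fst e)))"
    "continuous_map (disc_space (cdim K (fst e))) (universal_cover X b) (snd e)"
    "\<And>v. v \<in> disc (cdim K (fst e)) \<Longrightarrow> cover_proj (snd e v) = charmap K (fst e) v"
    "\<And>v. v \<in> disc (cdim K (fst e)) \<Longrightarrow> snd e v \<in> cover_points X b"
proof -
  show *: "fst e \<in> cells K" "int (cdim K (fst e)) = n" "snd e \<in> extensional (disc (cdim K (fst e)))"
    "continuous_map (disc_space (cdim K (fst e))) (universal_cover X b) (snd e)"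
    "\<And>v. v \<in> disc (cdim K (fst e)) \<Longrightarrow> cover_proj (snd e v) = charmap K (fst e) v"
    using assms by (auto simp: cover_cells_def)
  show "\<And>v. v \<in> disc (cdim K (fst e)) \<Longrightarrow> snd e v \<in> cover_points X b"
    using continuous_map_image_subset_topspace[OF *(4)]
    unfolding topspace_disc_space topspace_universal_cover by blast
qed

lemma fst_translate_cell [simp]: "fst (translate_cell X K g e) = fst e"
  by (simp add: translate_cell_def)

lemma snd_translate_cell:
  "v \<in> disc (cdim K (fst e)) \<Longrightarrow> snd (translate_cell X K g e) v = class_join X g (snd e v)"
  by (simp add: translate_cell_def)

lemma translate_cell_closed:
  assumes "b \<in> X" "g \<in> carrier (fundamental_group X b)" "e \<in> cover_cells X b K n"
  shows "translate_cell X K g e \<in> cover_cells X b K n"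
proof -
  note e = cover_cellsD[OF assms(3)]
  have "continuous_map (disc_space (cdim K (fst e))) (universal_cover X b) (class_join X g \<circ> snd e)"
    by (rule continuous_map_compose[OF e(4) continuous_map_class_join[OF assms(1,2)]])
  then have "continuous_map (disc_space (cdim K (fst e))) (universal_cover X b) (snd (translate_cell X K g e))"
    by (rule continuous_map_eq) (simp add: topspace_disc_space snd_translate_cell)
  moreover have "cover_proj (snd (translate_cell X K g e) v) = charmap K (fst e) v"
    if "v \<in> disc (cdim K (fst e))" for v
    using that e(5,6) cover_proj_class_join[OF assms(2)] by (simp add: snd_translate_cell)
  moreover have "snd (translate_cell X K g e) \<in> extensional (disc (cdim K (fst e)))"
    by (simp add: translate_cell_def)
  ultimately show ?thesis
    using e(1,2) unfolding cover_cells_def by (simp add: case_prod_beta)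
qed

lemma free_action_translate_cell:
  assumes "b \<in> X"
  shows "free_action (fundamental_group X b) (cover_cells X b K n) (translate_cell X K)"
proof (intro free_action.intro free_action_axioms.intro)
  let ?G = "fundamental_group X b"
  show "group ?G" by (rule group_fundamental_group[OF assms])
  fix e assume e: "e \<in> cover_cells X b K n"
  note e' = cover_cellsD[OF e]
  show "translate_cell X K \<one>\<^bsub>?G\<^esub> e = e"
  proof (rule prod_eqI)
    show "snd (translate_cell X K \<one>\<^bsub>?G\<^esub> e) = snd e"
    \<comment> \<open>Lifts are extensional on the disc, so agreement on the disc gives equality of
      cells.\<close>
    proof (rule extensionalityI)
      show "snd (translate_cell X K \<one>\<^bsub>?G\<^esub> e) \<in> extensional (disc (cdim K (fst e)))"
        by (simp add: translate_cell_def)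
    qed (simp_all add: e'(3) snd_translate_cell fundamental_group_simps class_join_one[OF assms] e'(6))
  qed simp
  fix g assume g: "g \<in> carrier ?G"
  show "translate_cell X K g e \<in> cover_cells X b K n"
    by (rule translate_cell_closed[OF assms g e])
  \<comment> \<open>A cell carries its parametrisation, so a fixed cell is fixed pointwise, and
    freeness on points applies at the centre.\<close>
  show "g = \<one>\<^bsub>?G\<^esub>" if "translate_cell X K g e = e"
  proof -
    have "class_join X g (snd e (\<lambda>_. 0)) = snd e (\<lambda>_. 0)"
      using that snd_translate_cell[OF zero_in_disc, where X = X and K = K and g = g and e = e] by simp
    then show ?thesis
      unfolding fundamental_group_simps by (rule class_join_free[OF g e'(6)[OF zero_in_disc]])
  qed
  fix h assume h: "h \<in> carrier ?G"
  show "translate_cell X K (g \<otimes>\<^bsub>?G\<^esub> h) e = translate_cell X K g (translate_cell X K h e)"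
    by (simp add: translate_cell_def fundamental_group_simps(2) class_join_assoc[OF g h e'(6)] cong: restrict_cong)
qed

lemma class_join_inj:
  assumes "b \<in> X" "g \<in> carrier (fundamental_group X b)"
  shows "inj_on (class_join X g) (cover_points X b)"
proof (rule inj_onI)
  let ?G = "fundamental_group X b"
  interpret group ?G by (rule group_fundamental_group[OF assms(1)])
  fix y z assume yz: "y \<in> cover_points X b" "z \<in> cover_points X b" "class_join X g y = class_join X g z"
  have "class_join X (inv\<^bsub>?G\<^esub> g) (class_join X g u) = u" if "u \<in> cover_points X b" for u
  proof -
    have "class_join X (inv\<^bsub>?G\<^esub> g) (class_join X g u) = class_join X (inv\<^bsub>?G\<^esub> g \<otimes>\<^bsub>?G\<^esub> g) u"
      using class_join_assoc[OF inv_closed[OF assms(2)] assms(2) that]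
      by (simp only: fundamental_group_simps(2))
    also have "\<dots> = u"
      using assms(2) class_join_one[OF assms(1) that] by (simp add: fundamental_group_simps(3))
    finally show ?thesis .
  qed
  with yz show "y = z" by metis
qed

text \<open>Translation is injective on points of the cover, so both collapses look for the same
  parameter \<open>v\<close> in the open disc and fall back to the pole in the same cases.\<close>

lemma cell_collapse_translate:
  assumes "b \<in> X" "g \<in> carrier (fundamental_group X b)" "f \<in> cover_cells X b K n" "y \<in> cover_points X b"
  shows "cell_collapse (cdim K (fst f)) (snd (translate_cell X K g f)) (class_join X g y)
    = cell_collapse (cdim K (fst f)) (snd f) y"
proof -
  have eq: "snd (translate_cell X K g f) v = class_join X g y \<longleftrightarrow> snd f v = y"
    if "v \<in> open_disc (cdim K (fst f))" for v
  proof -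
    have v: "v \<in> disc (cdim K (fst f))"
      using that open_disc_subset by blast
    show ?thesis
      using inj_onD[OF class_join_inj[OF assms(1,2)] _ cover_cellsD(6)[OF assms(3) v] assms(4)]
      by (auto simp: snd_translate_cell[OF v])
  qed
  have "class_join X g y \<in> snd (translate_cell X K g f) ` open_disc (cdim K (fst f))
      \<longleftrightarrow> y \<in> snd f ` open_disc (cdim K (fst f))"
    unfolding image_iff
    by (intro bex_cong[OF refl]) (simp add: eq eq_commute[of "class_join X g y"] eq_commute[of y])
  moreover have "(\<lambda>v. v \<in> open_disc (cdim K (fst f)) \<and> snd (translate_cell X K g f) v = class_join X g y)
      = (\<lambda>v. v \<in> open_disc (cdim K (fst f)) \<and> snd f v = y)"
    by (intro ext conj_cong refl eq)
  ultimately show ?thesis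
    by (simp add: cell_collapse_def)
qed

text \<open>The Brouwer degree depends only on values on the sphere. As \<open>e\<close> has one
  dimension more than \<open>f\<close>, that sphere lies in the disc of \<open>e\<close>, where the
  two composites agree.\<close>

lemma incidence_translate:
  assumes "b \<in> X" "g \<in> carrier (fundamental_group X b)" "e \<in> cover_cells X b K n" "f \<in> cover_cells X b K (n - 1)"
  shows "incidence K (translate_cell X K g e) (translate_cell X K g f) = incidence K e f"
  unfolding incidence_def fst_translate_cell
proof (rule Brouwer_degree2_eq)
  fix v assume "v \<in> topspace (nsphere (cdim K (fst f)))"
  then have "v \<in> disc (Suc (cdim K (fst f)))"
    using nsphere_subset_disc by blast
  moreover have "cdim K (fst e) = Suc (cdim K (fst f))"
    using cover_cellsD(2)[OF assms(3)] cover_cellsD(2)[OF assms(4)] by simp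
  ultimately have v: "v \<in> disc (cdim K (fst e))" by simp
  then show "(cell_collapse (cdim K (fst f)) (snd (translate_cell X K g f)) \<circ> snd (translate_cell X K g e)) v
      = (cell_collapse (cdim K (fst f)) (snd f) \<circ> snd e) v"
    using cell_collapse_translate[OF assms(1,2,4) cover_cellsD(6)[OF assms(3) v]]
    by (simp add: snd_translate_cell)
qed

lemma group_ring_action_eq: "group_ring_action X K = free_action.perm_action (translate_cell X K)" if "b \<in> X"
proof -
  \<comment> \<open>Degree 0 is an arbitrary instance: \<open>perm_action\<close> is determined by
    the translations alone.\<close>
  interpret free_action "fundamental_group X b" "cover_cells X b K 0" "translate_cell X K"
    by (rule free_action_translate_cell[OF that])
  show ?thesis
    by (simp add: fun_eq_iff group_ring_action_def perm_action_def)
qed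

lemma cellular_chains_eq: "cellular_chains X b K n = free_action.chains (cover_cells X b K n)" if "b \<in> X"
proof -
  interpret free_action "fundamental_group X b" "cover_cells X b K n" "translate_cell X K"
    by (rule free_action_translate_cell[OF that])
  show ?thesis
    by (simp add: cellular_chains_def chains_def)
qed

section \<open>Linearity and equivariance of the cellular boundary\<close>

lemma cellular_boundary_add:
  "cellular_boundary X b K n (c + d) = cellular_boundary X b K n c + cellular_boundary X b K n d"
  unfolding cellular_boundary_def
  by (rule setsum_keys_plus_distrib[where f = "\<lambda>e a. \<Sum>f\<in>{f \<in> cover_cells X b K (n - 1). incidence K e f \<noteq> 0}.
        Poly_Mapping.single f (a * of_int (incidence K e f))"])
    (simp_all add: distrib_right single_add sum.distrib)

lemma cellular_boundary_zero: "cellular_boundary X b K n 0 = 0"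
  by (simp add: cellular_boundary_def)

lemma cellular_boundary_sum:
  "cellular_boundary X b K n (sum h I) = (\<Sum>i\<in>I. cellular_boundary X b K n (h i))"
  by (induction I rule: infinite_finite_induct) (simp_all add: cellular_boundary_zero cellular_boundary_add)

lemma cellular_boundary_single:
  "cellular_boundary X b K n (Poly_Mapping.single e a)
   = (\<Sum>f\<in>{f \<in> cover_cells X b K (n - 1). incidence K e f \<noteq> 0}.
        Poly_Mapping.single f (a * of_int (incidence K e f)))"
  by (cases "a = 0") (simp_all add: cellular_boundary_def)

lemma cellular_boundary_closed: "cellular_boundary X b K n c \<in> cellular_chains X b K (n - 1)"
  unfolding cellular_boundary_def cellular_chains_def mem_Collect_eq
  by (intro keys_sum_subset) auto

lemma group_ring_action_add:
  "group_ring_action X K a (c + d) = group_ring_action X K a c + group_ring_action X K a d"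
proof -
  have "(\<Sum>e\<in>Poly_Mapping.keys (c + d). Poly_Mapping.single (translate_cell X K g e)
        (Poly_Mapping.lookup a g * Poly_Mapping.lookup (c + d) e))
    = (\<Sum>e\<in>Poly_Mapping.keys c. Poly_Mapping.single (translate_cell X K g e)
        (Poly_Mapping.lookup a g * Poly_Mapping.lookup c e))
      + (\<Sum>e\<in>Poly_Mapping.keys d. Poly_Mapping.single (translate_cell X K g e)
        (Poly_Mapping.lookup a g * Poly_Mapping.lookup d e))" for g
    by (rule setsum_keys_plus_distrib[where f = "\<lambda>e \<alpha>. Poly_Mapping.single (translate_cell X K g e) (Poly_Mapping.lookup a g * \<alpha>)"])
      (simp_all add: distrib_left single_add)
  then show ?thesis
    unfolding group_ring_action_def by (simp add: sum.distrib)
qed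

lemma group_ring_action_zero: "group_ring_action X K a 0 = 0"
  by (simp add: group_ring_action_def)

lemma group_ring_action_sum:
  "group_ring_action X K a (sum h I) = (\<Sum>i\<in>I. group_ring_action X K a (h i))"
  by (induction I rule: infinite_finite_induct) (simp_all add: group_ring_action_zero group_ring_action_add)

lemma group_ring_action_single:
  "group_ring_action X K a (Poly_Mapping.single e \<alpha>)
   = (\<Sum>g\<in>Poly_Mapping.keys a. Poly_Mapping.single (translate_cell X K g e) (Poly_Mapping.lookup a g * \<alpha>))"
  by (cases "\<alpha> = 0") (simp_all add: group_ring_action_def)

text \<open>Translation by g is a bijection from the cells incident to e onto those incident to g e,
  and it preserves incidence numbers. The rest is linearity and exchange of finite sums.\<close>

lemma cellular_boundary_action:
  fixes a :: "(real \<Rightarrow> 'a::topological_space) set \<Rightarrow>\<^sub>0 'k::comm_ring_1"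
    and c :: "('i, 'a) cover_cell \<Rightarrow>\<^sub>0 'k"
  assumes "b \<in> X" "a \<in> group_ring_carrier (fundamental_group X b)" "c \<in> cellular_chains X b K n"
  shows "cellular_boundary X b K n (group_ring_action X K a c)
    = group_ring_action X K a (cellular_boundary X b K n c)"
proof -
  interpret free_action "fundamental_group X b" "cover_cells X b K (n - 1)" "translate_cell X K"
    by (rule free_action_translate_cell[OF assms(1)])
  let ?t = "translate_cell X K"
  let ?I = "\<lambda>e. {f \<in> cover_cells X b K (n - 1). incidence K e f \<noteq> 0}"
  have boundary_translate: "cellular_boundary X b K n (Poly_Mapping.single (?t g e) \<alpha>)
      = (\<Sum>f\<in>?I e. Poly_Mapping.single (?t g f) (\<alpha> * of_int (incidence K e f)))"
    if g: "g \<in> carrier (fundamental_group X b)" and e: "e \<in> cover_cells X b K n" for g e and \<alpha> :: 'k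
  proof -
    have inverse: "?t (inv\<^bsub>fundamental_group X b\<^esub> g) (?t g f) = f" "?t g (?t (inv\<^bsub>fundamental_group X b\<^esub> g) f) = f"
      if "f \<in> cover_cells X b K (n - 1)" for f
      using that g tr_mult[of "inv\<^bsub>fundamental_group X b\<^esub> g" g f] tr_mult[of g "inv\<^bsub>fundamental_group X b\<^esub> g" f]
      by (simp_all add: tr_one)
    have inc: "incidence K (?t g e) (?t g f) = incidence K e f" if "f \<in> cover_cells X b K (n - 1)" for f
      by (rule incidence_translate[OF assms(1) g e that])
    have inj: "inj_on (?t g) (?I e)"
      by (rule inj_on_inverseI[of _ "?t (inv\<^bsub>fundamental_group X b\<^esub> g)"]) (simp add: inverse)
    \<comment> \<open>A cell f incident to g e is the translate by g of g^-1 f, which is incident to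
      e.\<close>
    have img: "?I (?t g e) = ?t g ` ?I e"
    proof (intro equalityI subsetI)
      fix f assume "f \<in> ?I (?t g e)"
      then have f: "f \<in> cover_cells X b K (n - 1)" "incidence K (?t g e) f \<noteq> 0" by auto
      let ?f = "?t (inv\<^bsub>fundamental_group X b\<^esub> g) f"
      have "?f \<in> cover_cells X b K (n - 1)"
        using f g by (intro tr_closed) auto
      moreover have "f = ?t g ?f"
        using inverse f by simp
      ultimately show "f \<in> ?t g ` ?I e"
        using inc[of ?f] f(2) by (intro image_eqI[of _ _ ?f]) auto
    qed (use inc tr_closed g in auto)
    show ?thesis
      unfolding cellular_boundary_single img sum.reindex[OF inj] using inc
      by (intro sum.cong) simp_all
  qed
  have "cellular_boundary X b K n (group_ring_action X K a c)
    = (\<Sum>g\<in>Poly_Mapping.keys a. \<Sum>e\<in>Poly_Mapping.keys c. \<Sum>f\<in>?I e. Poly_Mapping.single (?t g f)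
        (Poly_Mapping.lookup a g * Poly_Mapping.lookup c e * of_int (incidence K e f)))"
    unfolding group_ring_action_def cellular_boundary_sum using assms(2,3)
    by (intro sum.cong refl boundary_translate) (auto simp: group_ring_carrier_def cellular_chains_def)
  also have "\<dots> = (\<Sum>e\<in>Poly_Mapping.keys c. \<Sum>f\<in>?I e. \<Sum>g\<in>Poly_Mapping.keys a. Poly_Mapping.single (?t g f)
        (Poly_Mapping.lookup a g * Poly_Mapping.lookup c e * of_int (incidence K e f)))"
    by (subst sum.swap, rule sum.cong[OF refl], rule sum.swap)
  also have "\<dots> = group_ring_action X K a (cellular_boundary X b K n c)"
    unfolding cellular_boundary_def group_ring_action_sum group_ring_action_single
    by (simp add: mult.assoc)
  finally show ?thesis .
qed

section \<open>The equivariant complex\<close>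

text \<open>The tensor product of the identity with an additive, equivariant map is well defined,
  since such a map sends each relator to a relator of the same kind.\<close>

lemma (in tensor_product) coset_map_tensor:
  assumes D: "tensor_product P D act'"
    and f_closed: "\<And>c. c \<in> C \<Longrightarrow> f c \<in> D"
    and f_add: "\<And>c d. c \<in> C \<Longrightarrow> d \<in> C \<Longrightarrow> f (c + d) = f c + f d"
    and f_act: "\<And>a c. a \<in> P \<Longrightarrow> c \<in> C \<Longrightarrow> f (act a c) = act' a (f c)"
    and u: "u \<in> carrier pairs"
  shows "coset_map (pairs_module D) (tensor_kernel \<rho> P D act') (frag_extend (\<lambda>(r, c). frag_of (r, f c)))
      (kernel +>\<^bsub>pairs\<^esub> u)
    = tensor_kernel \<rho> P D act' +>\<^bsub>pairs_module D\<^esub> frag_extend (\<lambda>(r, c). frag_of (r, f c)) u"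
proof -
  interpret D: tensor_product \<rho> P D act' by fact
  let ?f = "frag_extend (\<lambda>(r, c). frag_of (r, f c))"
  have "?f v \<in> D.kernel" if "v \<in> kernel" for v
    using that
  proof (induction rule: kernel_induct)
    case (add_left r s c)
    then show ?case
      using D.kernel_add_left f_closed by (simp add: frag_extend_diff)
  next
    case (add_right r c d)
    then show ?case
      using D.kernel_add_right f_closed by (simp add: frag_extend_diff f_add)
  next
    case (balanced r a c)
    then show ?case
      using D.kernel_balanced f_closed by (simp add: frag_extend_diff f_act)
  qed (simp_all add: D.kernel_zero frag_extend_diff D.kernel_diff)
  moreover have "?f v \<in> carrier (pairs_module D)" if "v \<in> carrier pairs" for v
    by (rule frag_extend_closed[OF _ that]) (simp add: f_closed)
  ultimately show ?thesis
    by (intro coset_map_coset N.is_abelian_subgroup D.N.is_abelian_subgroup u)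
      (auto simp: frag_extend_add)
qed

text \<open>What the Laurent polynomials and the power series have in common; each becomes one
  interpretation.\<close>

locale twisted_cover =
  fixes X :: "'a::topological_space set" and b :: 'a and K :: "('i, 'a) cell_structure"
    and \<rho> :: "((real \<Rightarrow> 'a) set \<Rightarrow>\<^sub>0 'k::comm_ring_1) \<Rightarrow> 'r::comm_ring_1"
    and \<epsilon> :: "'k \<Rightarrow> 'r" and w :: "(real \<Rightarrow> 'a) set \<Rightarrow> 'r" and x :: 'r
  assumes base: "b \<in> X"
    and \<epsilon>_add: "\<epsilon> (\<alpha> + \<beta>) = \<epsilon> \<alpha> + \<epsilon> \<beta>" and \<epsilon>_mult: "\<epsilon> (\<alpha> * \<beta>) = \<epsilon> \<alpha> * \<epsilon> \<beta>"
    and \<epsilon>_one: "\<epsilon> 1 = 1"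
    and w_mult: "g \<in> carrier (fundamental_group X b) \<Longrightarrow> h \<in> carrier (fundamental_group X b) \<Longrightarrow>
      w (g \<otimes>\<^bsub>fundamental_group X b\<^esub> h) = w g * w h"
    and w_one: "w \<one>\<^bsub>fundamental_group X b\<^esub> = 1"
    and \<rho>: "\<rho> a = (\<Sum>g\<in>Poly_Mapping.keys a. \<epsilon> (Poly_Mapping.lookup a g) * w g)"
    and x_regular: "x * r = 0 \<Longrightarrow> r = 0"
begin

abbreviation P :: "((real \<Rightarrow> 'a) set \<Rightarrow>\<^sub>0 'k) set" where
  "P \<equiv> group_ring_carrier (fundamental_group X b)"

lemma free_permutation_module_cells:
  "free_permutation_module (fundamental_group X b) (cover_cells X b K n) (translate_cell X K) \<rho> \<epsilon> w"
  by (intro free_permutation_module.intro free_permutation_module_axioms.intro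
      free_action_translate_cell base \<epsilon>_add \<epsilon>_mult \<epsilon>_one w_mult w_one \<rho>)

lemma tensor_product_chains:
  "tensor_product P (cellular_chains X b K n :: (('i, 'a) cover_cell \<Rightarrow>\<^sub>0 'k) set) (group_ring_action X K)"
proof -
  interpret free_permutation_module "fundamental_group X b" "cover_cells X b K n" "translate_cell X K" \<rho> \<epsilon> w
    by (rule free_permutation_module_cells)
  show ?thesis
    unfolding cellular_chains_eq[OF base] group_ring_action_eq[OF base] by (rule tensor_product_axioms)
qed

sublocale T: tensor_product \<rho> P "cellular_chains X b K n" "group_ring_action X K" for n
  by (rule tensor_product_chains)

text \<open>Linearity of the differential is computed on combinations of pairs representing the
  cosets; regularity comes from the coordinates of the free permutation module of cells in each
  degree.\<close>

lemma regular_complex_equivariant: "regular_complex (equivariant_complex X b K \<rho>) x"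
proof (rule regular_complex.intro)
  let ?C = "equivariant_complex X b K \<rho>"
  let ?d = "\<lambda>n. frag_extend (\<lambda>(r, c). frag_of (r, cellular_boundary X b K n c))"
  have chain_mod: "chain_mod ?C n = tensor_module \<rho> P (cellular_chains X b K n) (group_ring_action X K)" for n
    by (simp add: equivariant_complex_def Let_def)
  have diff_coset: "diff ?C n (T.kernel n +>\<^bsub>T.pairs n\<^esub> u) = T.kernel (n - 1) +>\<^bsub>T.pairs (n - 1)\<^esub> ?d n u"
    if "u \<in> carrier (T.pairs n)" for n u
    using T.coset_map_tensor[OF tensor_product_chains cellular_boundary_closed cellular_boundary_add
        cellular_boundary_action[OF base] that]
    by (simp add: equivariant_complex_def Let_def)
  have d_closed: "?d n u \<in> carrier (T.pairs (n - 1))" if "u \<in> carrier (T.pairs n)" for n u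
    by (rule T.frag_extend_closed[OF _ that]) (simp add: cellular_boundary_closed)
  have rep: "\<exists>u. u \<in> carrier (T.pairs n) \<and> z = T.kernel n +>\<^bsub>T.pairs n\<^esub> u" if "z \<in> carrier (chain_mod ?C n)" for z n
    using that unfolding chain_mod tensor_module_def quotient_module_simps by blast
  fix n r z
  show "Module.module type_ring (chain_mod ?C n)"
    unfolding chain_mod by (rule T.module_tensor_module)
  assume z: "z \<in> carrier (chain_mod ?C n)"
  then obtain u where u: "u \<in> carrier (T.pairs n)" "z = T.kernel n +>\<^bsub>T.pairs n\<^esub> u"
    using rep by blast
  show "diff ?C n z \<in> carrier (chain_mod ?C (n - 1))"
    unfolding u(2) diff_coset[OF u(1)] chain_mod by (rule T.coset_in_tensor[OF d_closed[OF u(1)]])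
  have "?d n (r \<odot>\<^bsub>T.pairs n\<^esub> u) = r \<odot>\<^bsub>T.pairs (n - 1)\<^esub> ?d n u"
    using u(1)[simplified]
  proof (induction rule: frag_induction)
    case (one p)
    then show ?case by (cases p) simp
  qed (simp_all add: frag_extend_diff)
  then show "diff ?C n (r \<odot>\<^bsub>chain_mod ?C n\<^esub> z) = r \<odot>\<^bsub>chain_mod ?C (n - 1)\<^esub> diff ?C n z"
    unfolding u(2) chain_mod
    by (simp only: T.smult_coset[OF u(1)] diff_coset[OF u(1)] diff_coset[OF T.scale_closed[OF u(1)]]
        T.smult_coset[OF d_closed[OF u(1)]])
  show "z = \<zero>\<^bsub>chain_mod ?C n\<^esub>" if "x \<odot>\<^bsub>chain_mod ?C n\<^esub> z = \<zero>\<^bsub>chain_mod ?C n\<^esub>"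
  proof -
    interpret F: free_permutation_module "fundamental_group X b" "cover_cells X b K n" "translate_cell X K" \<rho> \<epsilon> w
      by (rule free_permutation_module_cells)
    show ?thesis
      using F.tensor_regular[OF x_regular] z that
      unfolding chain_mod cellular_chains_eq[OF base] group_ring_action_eq[OF base] by blast
  qed
  fix y assume "y \<in> carrier (chain_mod ?C n)"
  then obtain v where v: "v \<in> carrier (T.pairs n)" "y = T.kernel n +>\<^bsub>T.pairs n\<^esub> v"
    using rep by blast
  have "v \<oplus>\<^bsub>T.pairs n\<^esub> u \<in> carrier (T.pairs n)"
    by (intro abelian_monoid.a_closed[OF abelian_group.axioms(1)[OF abelian_group_pairs_module]] u(1) v(1))
  moreover have "?d n (v \<oplus>\<^bsub>T.pairs n\<^esub> u) = ?d n v \<oplus>\<^bsub>T.pairs (n - 1)\<^esub> ?d n u"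
    by (simp add: frag_extend_add)
  ultimately show "diff ?C n (y \<oplus>\<^bsub>chain_mod ?C n\<^esub> z) = diff ?C n y \<oplus>\<^bsub>chain_mod ?C (n - 1)\<^esub> diff ?C n z"
    unfolding u(2) v(2) chain_mod tensor_module_def quotient_module_simps
    by (simp only: T.N.a_rcos_sum[OF v(1) u(1)] diff_coset u(1) v(1)
        T.N.a_rcos_sum[OF d_closed[OF v(1)] d_closed[OF u(1)]])
qed

end

section \<open>The two coefficient rings\<close>

lemma lookup_t_times:
  "Poly_Mapping.lookup (Poly_Mapping.single (1::int) 1 * p) k = Poly_Mapping.lookup (p :: int \<Rightarrow>\<^sub>0 'k::comm_ring_1) (k - 1)"
proof -
  have "Poly_Mapping.single 1 1 * p = (\<Sum>n\<in>Poly_Mapping.keys p. Poly_Mapping.single (1 + n) (Poly_Mapping.lookup p n))"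
    by (subst poly_mapping_sum_single[of p]) (simp add: sum_distrib_left mult_single)
  then have "Poly_Mapping.lookup (Poly_Mapping.single 1 1 * p) k
      = (\<Sum>n\<in>Poly_Mapping.keys p. if n = k - 1 then Poly_Mapping.lookup p n else 0)"
    by (simp add: lookup_sum lookup_single when_def eq_diff_eq add.commute)
  then show ?thesis
    by (simp add: in_keys_iff)
qed

text \<open>If (t - 1) p = 0, then p = t p, so shifting by one leaves the coefficients unchanged.
  One nonzero coefficient would then give infinitely many, against finite support.\<close>

lemma laurent_x_regular:
  fixes p :: "int \<Rightarrow>\<^sub>0 'k::comm_ring_1"
  assumes "laurent_x * p = 0"
  shows "p = 0"
proof (rule ccontr)
  assume "p \<noteq> 0"
  then obtain k where k: "Poly_Mapping.lookup p k \<noteq> 0"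
    by (metis lookup_zero poly_mapping_eqI)
  have "Poly_Mapping.single 1 1 * p = p"
    using assms by (simp add: laurent_x_def left_diff_distrib)
  then have shift: "Poly_Mapping.lookup p (n - 1) = Poly_Mapping.lookup p n" for n
    by (metis lookup_t_times)
  have "Poly_Mapping.lookup p (k + int m) = Poly_Mapping.lookup p k" for m
  proof (induction m)
    case (Suc m)
    then show ?case
      using shift[of "k + int (Suc m)"] by (simp add: algebra_simps)
  qed simp
  then have "range (\<lambda>m. k + int m) \<subseteq> Poly_Mapping.keys p"
    using k by (auto simp: in_keys_iff)
  then have "finite (range (\<lambda>m. k + int m))"
    using finite_subset finite_keys by blast
  then show False
    using finite_imageD[of "\<lambda>m. k + int m" UNIV] by (simp add: inj_on_def)
qed

lemma fps_X_regular:
  fixes p :: "'k::comm_ring_1 fps"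
  assumes "fps_X * p = 0"
  shows "p = 0"
proof (rule fps_ext)
  fix n
  have "(fps_X * p) $ Suc n = 0"
    using assms by simp
  then show "p $ n = 0 $ n"
    by (simp add: fps_X_mult_nth)
qed

lemma one_plus_X_times_geometric: "(1 + fps_X) * Abs_fps (\<lambda>j. (- 1) ^ j) = (1 :: 'k::comm_ring_1 fps)"
proof (rule fps_ext)
  fix n
  show "((1 + fps_X) * Abs_fps (\<lambda>j. (- 1) ^ j)) $ n = (1 :: 'k fps) $ n"
    by (cases n) (simp_all add: distrib_right fps_X_mult_nth)
qed

lemma one_plus_x_power_succ: "one_plus_x_power (n + 1) = (1 + fps_X) * (one_plus_x_power n :: 'k::comm_ring_1 fps)"
proof (cases "n \<ge> 0")
  case True
  then show ?thesis
    by (simp add: one_plus_x_power_def nat_add_distrib)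
next
  case False
  define m where "m = nat (- n - 1)"
  have nat: "nat (- n) = Suc m" "nat (- n - 1) = m"
    using False by (simp_all add: m_def)
  have "(1 + fps_X) * one_plus_x_power n = ((1 + fps_X) * Abs_fps (\<lambda>j. (- 1) ^ j)) * (Abs_fps (\<lambda>j. (- 1) ^ j) ^ m :: 'k fps)"
    using False nat(1) by (simp add: one_plus_x_power_def mult.assoc)
  also have "\<dots> = one_plus_x_power (n + 1)"
  \<comment> \<open>At n = -1 the successor is 0, which belongs to the other branch of the
    definition.\<close>
  proof (cases "n = - 1")
    case True
    then show ?thesis
      by (simp add: m_def one_plus_x_power_def one_plus_X_times_geometric)
  next
    case neq: False
    have "nat (- (n + 1)) = m"
      by (simp add: m_def)
    then show ?thesis
      using False neq by (simp add: one_plus_x_power_def one_plus_X_times_geometric)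
  qed
  finally show ?thesis ..
qed

lemma one_plus_x_power_0: "one_plus_x_power 0 = 1"
  by (simp add: one_plus_x_power_def)

text \<open>Turns additivity of \<nu> into multiplicativity of the weight. The induction runs in
  both directions from 0; going down, the unit 1 + x is cancelled.\<close>

lemma one_plus_x_power_add:
  "one_plus_x_power (m + n) = one_plus_x_power m * (one_plus_x_power n :: 'k::comm_ring_1 fps)"
proof (induction m rule: int_induct[where k = 0])
  case (step1 m)
  have "one_plus_x_power (m + 1 + n) = (one_plus_x_power (m + n + 1) :: 'k fps)"
    by (simp add: add_ac)
  also have "\<dots> = one_plus_x_power (m + 1) * one_plus_x_power n"
    by (simp only: one_plus_x_power_succ step1.IH mult.assoc)
  finally show ?case .
next
  case (step2 m)
  have cancel: "u = v" if "(1 + fps_X) * u = (1 + fps_X) * v" for u v :: "'k fps"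
  proof -
    have "Abs_fps (\<lambda>j. (- 1) ^ j) * ((1 + fps_X) * u) = Abs_fps (\<lambda>j. (- 1) ^ j) * ((1 + fps_X) * v)"
      using that by simp
    then show ?thesis
      by (simp only: mult.assoc[symmetric] mult.commute[of _ "1 + fps_X"] one_plus_X_times_geometric mult_1_left)
  qed
  show ?case
  proof (rule cancel)
    have "(1 + fps_X) * one_plus_x_power (m - 1 + n) = (one_plus_x_power (m + n) :: 'k fps)"
      using one_plus_x_power_succ[of "m - 1 + n", where 'k = 'k] by (simp add: add_ac)
    also have "\<dots> = one_plus_x_power (m - 1 + 1) * one_plus_x_power n"
      using step2.IH by simp
    also have "\<dots> = (1 + fps_X) * (one_plus_x_power (m - 1) * one_plus_x_power n)"
      by (simp only: one_plus_x_power_succ mult.assoc)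
    finally show "(1 + fps_X) * one_plus_x_power (m - 1 + n)
        = (1 + fps_X) * (one_plus_x_power (m - 1) * one_plus_x_power n :: 'k fps)" .
  qed
qed (simp add: one_plus_x_power_0)

lemma completion_add: "completion (p + q) = completion p + completion q"
  unfolding completion_def
  by (rule setsum_keys_plus_distrib[where f = "\<lambda>n c. fps_const c * one_plus_x_power n"])
    (simp_all add: distrib_right flip: fps_const_add)

lemma completion_sum: "completion (sum h I) = (\<Sum>i\<in>I. completion (h i))"
  by (induction I rule: infinite_finite_induct) (simp_all add: completion_add, simp_all add: completion_def)

lemma completion_single: "completion (Poly_Mapping.single n c) = fps_const c * one_plus_x_power n"
  by (cases "c = 0") (simp_all add: completion_def)

theorem lemma8p4:
  fixes X :: "'a::topological_space set"
    and K :: "('i, 'a) cell_structure"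
    and b :: 'a
    and \<nu> :: "(real \<Rightarrow> 'a) set \<Rightarrow> int"
  assumes "cw_complex X K"
    and "connected X"
    and "b \<in> X"
    and "\<nu> \<in> epi (fundamental_group X b) integer_group"
  defines "C \<equiv> equivariant_complex X b K
                 (linear_extension \<nu> :: ((real \<Rightarrow> 'a) set \<Rightarrow>\<^sub>0 'k::comm_ring_1) \<Rightarrow> (int \<Rightarrow>\<^sub>0 'k))"
    and "D \<equiv> equivariant_complex X b K
                 (completion \<circ> linear_extension \<nu> :: ((real \<Rightarrow> 'a) set \<Rightarrow>\<^sub>0 'k::comm_ring_1) \<Rightarrow> 'k fps)"
  shows
    "((\<forall>(r::nat) (q::int).
         generated_submodule (graded_page laurent_const C laurent_x r q)
           (graded_page_degree_zero laurent_const C laurent_x r q)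
         = carrier (graded_page laurent_const C laurent_x r q)) \<and>
      (\<forall>(s::nat) (q::int).
         homology_filtration C laurent_x s q
         = (\<lambda>h. laurent_x ^ s \<odot>\<^bsub>homology C q\<^esub> h) ` carrier (homology C q))) \<and>
     ((\<forall>(r::nat) (q::int).
         generated_submodule (graded_page fps_const D fps_X r q)
           (graded_page_degree_zero fps_const D fps_X r q)
         = carrier (graded_page fps_const D fps_X r q)) \<and>
      (\<forall>(s::nat) (q::int).
         homology_filtration D fps_X s q
         = (\<lambda>h. fps_X ^ s \<odot>\<^bsub>homology D q\<^esub> h) ` carrier (homology D q)))"
proof -
  let ?G = "fundamental_group X b"
  interpret group ?G by (rule group_fundamental_group[OF assms(3)])
  have \<nu>_mult: "\<nu> (g \<otimes>\<^bsub>?G\<^esub> h) = \<nu> g + \<nu> h" if "g \<in> carrier ?G" "h \<in> carrier ?G" for g h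
    using assms(4) that by (auto simp: epi_def hom_def)
  \<comment> \<open>The value at the identity equals its own double.\<close>
  have \<nu>_one: "\<nu> \<one>\<^bsub>?G\<^esub> = 0"
    using \<nu>_mult[OF one_closed one_closed] by simp
  \<comment> \<open>The weight is t^\<nu>(g).\<close>
  interpret C: twisted_cover X b K "linear_extension \<nu> :: ((real \<Rightarrow> 'a) set \<Rightarrow>\<^sub>0 'k) \<Rightarrow> (int \<Rightarrow>\<^sub>0 'k)"
    laurent_const "\<lambda>g. Poly_Mapping.single (\<nu> g) 1" laurent_x
    by unfold_locales
      (simp_all add: assms(3) laurent_const_def single_add mult_single \<nu>_mult \<nu>_one linear_extension_def
        laurent_x_regular)
  \<comment> \<open>The weight is the image (1 + x)^\<nu>(g) of t^\<nu>(g) under the completion map,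
    whose additivity yields the formula for \<rho>.\<close>
  interpret D: twisted_cover X b K "completion \<circ> linear_extension \<nu> :: ((real \<Rightarrow> 'a) set \<Rightarrow>\<^sub>0 'k) \<Rightarrow> 'k fps"
    fps_const "\<lambda>g. one_plus_x_power (\<nu> g)" fps_X
    by unfold_locales
      (simp_all add: assms(3) \<nu>_mult \<nu>_one one_plus_x_power_add one_plus_x_power_0 linear_extension_def
        completion_sum completion_single fps_X_regular)
  interpret C: regular_complex C "laurent_x :: int \<Rightarrow>\<^sub>0 'k"
    unfolding C_def by (rule C.regular_complex_equivariant)
  interpret D: regular_complex D "fps_X :: 'k fps"
    unfolding D_def by (rule D.regular_complex_equivariant)
  show ?thesis
    by (simp add: C.graded_page_generated_in_degree_zero D.graded_page_generated_in_degree_zero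
        C.homology_filtration_eq D.homology_filtration_eq laurent_const_def)
qed

end
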